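(* Let $(\mathfrak M,\Phi,\varphi)$ be a quantum dynamical system with $\varphi$-adjoint $\Phi^\sharp$, let $(\mathcal H_\varphi,\pi_\varphi,\Omega_\varphi)$ be the GNS representation of $\varphi$, let $U=U_{\Phi,\varphi}$ be the associated contraction on $\mathcal H_\varphi$, and let $$\mathcal H_0=\{\psi\in\mathcal H_\varphi:\ \|U^n\psi\|=\|\psi\|=\|U^{*n}\psi\|\ \text{for all } n\in\mathbb N\}$$ be the unitary subspace in the Sz.-Nagy–Foias canonical decomposition of $U$. Then $$\mathcal H_0=\bigcap_{k\in\mathbb Z}\overline{\pi_\varphi(\mathfrak D_{\Phi_k})\Omega_\varphi},$$ where the bar denotes norm closure in $\mathcal H_\varphi$. Furthermore, for all $a\in\mathfrak M$, $\xi_0\in\mathcal H_0$ and $k\in\mathbb Z$, $$U_k\,\pi_\varphi(a)\,\xi_0=\pi_\varphi(\Phi_k(a))\,U_k\,\xi_0 .$$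
   Context: A unital Schwartz map on a von Neumann algebra $\mathfrak M$ is an ultraweakly continuous linear map $\Phi:\mathfrak M\to\mathfrak M$ with $\Phi(1)=1$ and $0\le\Phi(a^* )\Phi(a)\le\Phi(a^*a)$ for all $a\in\mathfrak M$. A quantum dynamical system $(\mathfrak M,\Phi,\varphi)$ consists of a von Neumann algebra $\mathfrak M$, a unital Schwartz map $\Phi$ on $\mathfrak M$, and a normal faithful state $\varphi$ on $\mathfrak M$ with $\varphi\circ\Phi=\varphi$, such that $\Phi$ admits a $\varphi$-adjoint, i.e. a normal unital Schwartz map $\Phi^\sharp:\mathfrak M\to\mathfrak M$ with $\varphi(b\Phi(a))=\varphi(\Phi^\sharp(b)a)$ for all $a,b\in\mathfrak M$. $U_{\Phi,\varphi}$ is the unique linear contraction on $\mathcal H_\varphi$ with $U_{\Phi,\varphi}\pi_\varphi(a)\Omega_\varphi=\pi_\varphi(\Phi(a))\Omega_\varphi$ for all $a\in\mathfrak M$. For a unital Schwartz map $\Psi$, its multiplicative domain is $\mathfrak D_\Psi=\{a\in\mathfrak M:\Psi(a^*a)=\Psi(a^* )\Psi(a)\text{ and }\Psi(aa^* )=\Psi(a)\Psi(a^* )\}$. For $k\in\mathbb Z$: $\Phi_k=\Phi^k$ and $U_k=U^k$ if $k\ge0$, while $\Phi_k=(\Phi^\sharp)^{|k|}$ and $U_k=(U^* )^{|k|}$ if $k<0$. *)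

theory Defs
  imports "HOL-Analysis.Analysis"
begin

section \<open>Complex Hilbert spaces\<close>

text \<open>The inner product is antilinear in its first and linear in its second argument.
  The norm axiom also yields positive definiteness.\<close>

class complex_inner = real_normed_vector +
  fixes scaleC :: "complex \<Rightarrow> 'a \<Rightarrow> 'a"
    and cinner :: "'a \<Rightarrow> 'a \<Rightarrow> complex"
  assumes scaleC_add_right: "scaleC c (x + y) = scaleC c x + scaleC c y"
    and scaleC_add_left: "scaleC (c + d) x = scaleC c x + scaleC d x"
    and scaleC_scaleC: "scaleC c (scaleC d x) = scaleC (c * d) x"
    and scaleR_scaleC: "scaleR r x = scaleC (complex_of_real r) x"
    and cinner_commute: "cinner x y = cnj (cinner y x)"
    and cinner_add_right: "cinner x (y + z) = cinner x y + cinner x z"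
    and cinner_scaleC_right: "cinner x (scaleC c y) = c * cinner x y"
    and cinner_self: "cinner x x = complex_of_real ((norm x)\<^sup>2)"

class chilbert_space = complex_inner + complete_space


section \<open>Bounded operators\<close>

text \<open>Operators are plain functions; their product is composition, and sums and scalar multiples
  are taken pointwise.\<close>

definition bounded_clinear :: "('a::complex_inner \<Rightarrow> 'b::complex_inner) \<Rightarrow> bool" where
  "bounded_clinear f \<longleftrightarrow> bounded_linear f \<and> (\<forall>c x. f (scaleC c x) = scaleC c (f x))"

definition bounded_ops :: "('h::chilbert_space \<Rightarrow> 'h) set" where
  "bounded_ops = {a. bounded_clinear a}"

definition cadjoint :: "('h::chilbert_space \<Rightarrow> 'h) \<Rightarrow> 'h \<Rightarrow> 'h" where
  "cadjoint a = (THE b. \<forall>x y. cinner (a x) y = cinner x (b y))"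

definition positive_op :: "('h::chilbert_space \<Rightarrow> 'h) \<Rightarrow> bool" where
  "positive_op a \<longleftrightarrow> a \<in> bounded_ops \<and> (\<forall>x. cinner x (a x) \<in> \<real>\<^sub>\<ge>\<^sub>0)"

definition op_le :: "('h::chilbert_space \<Rightarrow> 'h) \<Rightarrow> ('h \<Rightarrow> 'h) \<Rightarrow> bool" where
  "op_le a b \<longleftrightarrow> positive_op (\<lambda>x. b x - a x)"


section \<open>Von Neumann algebras and the ultraweak topology\<close>

definition commutant :: "('h::chilbert_space \<Rightarrow> 'h) set \<Rightarrow> ('h \<Rightarrow> 'h) set" where
  "commutant S = {b \<in> bounded_ops. \<forall>a\<in>S. a \<circ> b = b \<circ> a}"

definition von_neumann_algebra :: "('h::chilbert_space \<Rightarrow> 'h) set \<Rightarrow> bool" where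
  "von_neumann_algebra M \<longleftrightarrow>
     M \<subseteq> bounded_ops \<and> (\<forall>a\<in>M. cadjoint a \<in> M) \<and> commutant (commutant M) = M"

definition ultraweak_topology :: "('h::chilbert_space \<Rightarrow> 'h) topology" where
  "ultraweak_topology = topology_generated_by
     {{a \<in> bounded_ops. (\<Sum>n. cinner (x n) (a (y n))) \<in> V} |x y V.
        summable (\<lambda>n::nat. (norm (x n))\<^sup>2) \<and> summable (\<lambda>n. (norm (y n))\<^sup>2) \<and> open V}"

abbreviation ultraweak_on :: "('h::chilbert_space \<Rightarrow> 'h) set \<Rightarrow> ('h \<Rightarrow> 'h) topology" where
  "ultraweak_on M \<equiv> subtopology ultraweak_topology M"


section \<open>Schwartz maps, states and quantum dynamical systems\<close>

text \<open>Maps and functionals on \<open>M\<close> are total functions whose values off \<open>M\<close> play no role.\<close>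

definition linear_map_on ::
  "('h::chilbert_space \<Rightarrow> 'h) set \<Rightarrow> (('h \<Rightarrow> 'h) \<Rightarrow> ('g::chilbert_space \<Rightarrow> 'g)) \<Rightarrow> bool" where
  "linear_map_on M \<Phi> \<longleftrightarrow>
     (\<forall>a\<in>M. \<forall>b\<in>M. \<Phi> (\<lambda>x. a x + b x) = (\<lambda>x. \<Phi> a x + \<Phi> b x)) \<and>
     (\<forall>c. \<forall>a\<in>M. \<Phi> (\<lambda>x. scaleC c (a x)) = (\<lambda>x. scaleC c (\<Phi> a x)))"

definition linear_functional_on ::
  "('h::chilbert_space \<Rightarrow> 'h) set \<Rightarrow> (('h \<Rightarrow> 'h) \<Rightarrow> complex) \<Rightarrow> bool" where
  "linear_functional_on M \<phi> \<longleftrightarrow>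
     (\<forall>a\<in>M. \<forall>b\<in>M. \<phi> (\<lambda>x. a x + b x) = \<phi> a + \<phi> b) \<and>
     (\<forall>c. \<forall>a\<in>M. \<phi> (\<lambda>x. scaleC c (a x)) = c * \<phi> a)"

definition unital_schwartz_map ::
  "('h::chilbert_space \<Rightarrow> 'h) set \<Rightarrow> (('h \<Rightarrow> 'h) \<Rightarrow> ('h \<Rightarrow> 'h)) \<Rightarrow> bool" where
  "unital_schwartz_map M \<Phi> \<longleftrightarrow>
     (\<forall>a\<in>M. \<Phi> a \<in> M) \<and> linear_map_on M \<Phi> \<and>
     continuous_map (ultraweak_on M) (ultraweak_on M) \<Phi> \<and>
     \<Phi> id = id \<and>
     (\<forall>a\<in>M. op_le (\<lambda>x. 0) (\<Phi> (cadjoint a) \<circ> \<Phi> a) \<and>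
             op_le (\<Phi> (cadjoint a) \<circ> \<Phi> a) (\<Phi> (cadjoint a \<circ> a)))"

definition normal_faithful_state ::
  "('h::chilbert_space \<Rightarrow> 'h) set \<Rightarrow> (('h \<Rightarrow> 'h) \<Rightarrow> complex) \<Rightarrow> bool" where
  "normal_faithful_state M \<phi> \<longleftrightarrow>
     linear_functional_on M \<phi> \<and>
     (\<forall>a\<in>M. positive_op a \<longrightarrow> \<phi> a \<in> \<real>\<^sub>\<ge>\<^sub>0) \<and>
     \<phi> id = 1 \<and>
     continuous_map (ultraweak_on M) euclidean \<phi> \<and>
     (\<forall>a\<in>M. positive_op a \<and> \<phi> a = 0 \<longrightarrow> a = (\<lambda>x. 0))"

text \<open>Normality of the adjoint map is the ultraweak continuity contained in
  \<open>unital_schwartz_map\<close>.\<close>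

definition is_state_adjoint ::
  "('h::chilbert_space \<Rightarrow> 'h) set \<Rightarrow> (('h \<Rightarrow> 'h) \<Rightarrow> complex) \<Rightarrow>
   (('h \<Rightarrow> 'h) \<Rightarrow> ('h \<Rightarrow> 'h)) \<Rightarrow> (('h \<Rightarrow> 'h) \<Rightarrow> ('h \<Rightarrow> 'h)) \<Rightarrow> bool" where
  "is_state_adjoint M \<phi> \<Phi> \<Phi>' \<longleftrightarrow>
     unital_schwartz_map M \<Phi>' \<and> (\<forall>a\<in>M. \<forall>b\<in>M. \<phi> (b \<circ> \<Phi> a) = \<phi> (\<Phi>' b \<circ> a))"

definition quantum_dynamical_system ::
  "('h::chilbert_space \<Rightarrow> 'h) set \<Rightarrow> (('h \<Rightarrow> 'h) \<Rightarrow> ('h \<Rightarrow> 'h)) \<Rightarrow>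
   (('h \<Rightarrow> 'h) \<Rightarrow> complex) \<Rightarrow> bool" where
  "quantum_dynamical_system M \<Phi> \<phi> \<longleftrightarrow>
     von_neumann_algebra M \<and> unital_schwartz_map M \<Phi> \<and> normal_faithful_state M \<phi> \<and>
     (\<forall>a\<in>M. \<phi> (\<Phi> a) = \<phi> a) \<and> (\<exists>\<Phi>'. is_state_adjoint M \<phi> \<Phi> \<Phi>')"

definition multiplicative_domain ::
  "('h::chilbert_space \<Rightarrow> 'h) set \<Rightarrow> (('h \<Rightarrow> 'h) \<Rightarrow> ('h \<Rightarrow> 'h)) \<Rightarrow> ('h \<Rightarrow> 'h) set" where
  "multiplicative_domain M \<Psi> =
     {a \<in> M. \<Psi> (cadjoint a \<circ> a) = \<Psi> (cadjoint a) \<circ> \<Psi> a \<and>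
             \<Psi> (a \<circ> cadjoint a) = \<Psi> a \<circ> \<Psi> (cadjoint a)}"


section \<open>GNS representation and the associated contraction\<close>

text \<open>The GNS triple is determined by the following properties up to unitary equivalence; the type
  \<open>'g\<close> is the representation space.\<close>

definition gns_representation ::
  "('h::chilbert_space \<Rightarrow> 'h) set \<Rightarrow> (('h \<Rightarrow> 'h) \<Rightarrow> complex) \<Rightarrow>
   (('h \<Rightarrow> 'h) \<Rightarrow> ('g::chilbert_space \<Rightarrow> 'g)) \<Rightarrow> 'g \<Rightarrow> bool" where
  "gns_representation M \<phi> \<pi> \<Omega> \<longleftrightarrow>
     (\<forall>a\<in>M. \<pi> a \<in> bounded_ops) \<and> linear_map_on M \<pi> \<and> \<pi> id = id \<and>
     (\<forall>a\<in>M. \<forall>b\<in>M. \<pi> (a \<circ> b) = \<pi> a \<circ> \<pi> b) \<and>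
     (\<forall>a\<in>M. \<pi> (cadjoint a) = cadjoint (\<pi> a)) \<and>
     closure ((\<lambda>a. \<pi> a \<Omega>) ` M) = UNIV \<and>
     (\<forall>a\<in>M. \<phi> a = cinner \<Omega> (\<pi> a \<Omega>))"

text \<open>By density of the vectors \<open>\<pi> a \<Omega>\<close>, at most one \<open>U\<close> has the following property.\<close>

definition is_gns_contraction ::
  "('h::chilbert_space \<Rightarrow> 'h) set \<Rightarrow> (('h \<Rightarrow> 'h) \<Rightarrow> ('h \<Rightarrow> 'h)) \<Rightarrow>
   (('h \<Rightarrow> 'h) \<Rightarrow> ('g::chilbert_space \<Rightarrow> 'g)) \<Rightarrow> 'g \<Rightarrow> ('g \<Rightarrow> 'g) \<Rightarrow> bool" where
  "is_gns_contraction M \<Phi> \<pi> \<Omega> U \<longleftrightarrow>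
     bounded_clinear U \<and> (\<forall>\<psi>. norm (U \<psi>) \<le> norm \<psi>) \<and> (\<forall>a\<in>M. U (\<pi> a \<Omega>) = \<pi> (\<Phi> a) \<Omega>)"

definition unitary_subspace :: "('g::chilbert_space \<Rightarrow> 'g) \<Rightarrow> 'g set" where
  "unitary_subspace U =
     {\<psi>. \<forall>n::nat. norm ((U ^^ n) \<psi>) = norm \<psi> \<and> norm \<psi> = norm ((cadjoint U ^^ n) \<psi>)}"

text \<open>Iterates indexed by the integers, with \<open>g\<close> (not the inverse of \<open>f\<close>) iterated for negative
  indices.\<close>

definition int_iterate :: "('x \<Rightarrow> 'x) \<Rightarrow> ('x \<Rightarrow> 'x) \<Rightarrow> int \<Rightarrow> 'x \<Rightarrow> 'x" where
  "int_iterate f g k = (if 0 \<le> k then f ^^ nat k else g ^^ nat \<bar>k\<bar>)"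

end

theory Submission
  imports Defs
begin

text \<open>The vectors on which \<open>U\<^sub>k\<close> is isometric form the closure of \<open>\<pi>(D\<^sub>k)\<Omega>\<close> for every single \<open>k\<close>,
  where \<open>D\<^sub>k\<close> is the multiplicative domain of \<open>\<Phi>\<^sub>k\<close>; the first claim follows by intersecting over \<open>k\<close>.
  For \<open>a \<in> M\<close> the number \<open>\<phi>(\<Phi>\<^sub>k(a\<^sup>* a) - \<Phi>\<^sub>k(a)\<^sup>* \<Phi>\<^sub>k(a))\<close> is the difference of the squared norms of \<open>\<pi>(a)\<Omega>\<close>
  and \<open>U\<^sub>k \<pi>(a)\<Omega>\<close>, so by faithfulness the Schwarz inequality is an equality at \<open>a\<close> iff \<open>U\<^sub>k\<close> is isometric
  at \<open>\<pi>(a)\<Omega>\<close>. To approximate an isometric vector \<open>\<psi>\<close>, take \<open>\<pi>(a)\<Omega>\<close> near \<open>\<psi>\<close> and let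
  \<open>T = \<Phi>\<^sub>-\<^sub>k \<circ> \<Phi>\<^sub>k\<close>, which is implemented by the positive contraction \<open>U\<^sub>k\<^sup>* U\<^sub>k\<close>. Its powers converge strongly,
  moving \<open>\<pi>(a)\<Omega>\<close> to a fixed vector \<open>\<pi>(x)\<Omega>\<close> at most as far from \<open>\<psi>\<close>, where \<open>x\<close> is a weak cluster point of
  the bounded sequence \<open>T\<^sup>n(a)\<close>. Since \<open>x\<^sup>*\<close> is a cluster point of \<open>T\<^sup>n(a\<^sup>*)\<close>, both \<open>\<pi>(x)\<Omega>\<close> and \<open>\<pi>(x\<^sup>*)\<Omega>\<close>
  are isometric, so \<open>x \<in> D\<^sub>k\<close>. The intertwining relation holds on \<open>\<pi>(D\<^sub>k)\<Omega>\<close> by multiplicativity and extends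
  to its closure.\<close>

section \<open>Complex inner product spaces\<close>

lemma cinner_add_left: "cinner (x + y) z = cinner x z + cinner y z"
  by (metis cinner_add_right cinner_commute complex_cnj_add)

lemma cinner_scaleC_left: "cinner (scaleC c x) y = cnj c * cinner x y"
  by (metis cinner_commute cinner_scaleC_right complex_cnj_mult)

lemma scaleC_one [simp]: "scaleC 1 x = x"
  using scaleR_scaleC[of 1 x] by simp

lemma scaleC_minus_one: "scaleC (-1) x = - x"
  using scaleR_scaleC[of "-1" x] by simp

lemma scaleC_zero_left [simp]: "scaleC 0 x = 0"
  using scaleR_scaleC[of 0 x] by simp

lemma scaleC_zero_right [simp]: "scaleC c 0 = 0"
  by (metis add_cancel_right_left scaleC_add_right)

lemma cinner_zero_right [simp]: "cinner x 0 = 0"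
  by (metis add_cancel_right_left cinner_add_right)

lemma cinner_zero_left [simp]: "cinner 0 x = 0"
  by (metis add_cancel_right_left cinner_add_left)

lemma cinner_minus_right: "cinner x (- y) = - cinner x y"
  by (metis add_eq_0_iff cinner_add_right cinner_zero_right)

lemma cinner_minus_left: "cinner (- x) y = - cinner x y"
  by (metis add_eq_0_iff cinner_add_left cinner_zero_left)

lemma cinner_diff_right: "cinner x (y - z) = cinner x y - cinner x z"
  by (metis cinner_add_right cinner_minus_right diff_conv_add_uminus)

lemma cinner_diff_left: "cinner (x - y) z = cinner x z - cinner y z"
  by (metis cinner_add_left cinner_minus_left diff_conv_add_uminus)

lemma cinner_scaleR_right: "cinner x (scaleR r y) = complex_of_real r * cinner x y"
  by (simp add: scaleR_scaleC cinner_scaleC_right)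

lemma cinner_scaleR_left: "cinner (scaleR r x) y = complex_of_real r * cinner x y"
  by (simp add: scaleR_scaleC cinner_scaleC_left)

lemmas cinner_simps = cinner_add_left cinner_add_right cinner_diff_left cinner_diff_right
  cinner_minus_left cinner_minus_right cinner_scaleC_left cinner_scaleC_right
  cinner_scaleR_left cinner_scaleR_right

lemma power2_norm_eq_Re_cinner: "(norm x)\<^sup>2 = Re (cinner x x)"
  by (simp add: cinner_self)

lemma Re_cinner_commute: "Re (cinner x y) = Re (cinner y x)"
  by (subst cinner_commute) simp

lemma power2_norm_add:
  "(norm (x + y))\<^sup>2 = (norm x)\<^sup>2 + 2 * Re (cinner x y) + (norm (y::'a::complex_inner))\<^sup>2"
  using Re_cinner_commute[of x y] by (simp add: power2_norm_eq_Re_cinner cinner_simps)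

lemma power2_norm_diff:
  "(norm (x - y))\<^sup>2 = (norm x)\<^sup>2 - 2 * Re (cinner x y) + (norm (y::'a::complex_inner))\<^sup>2"
  using power2_norm_add[of x "- y"] by (simp add: cinner_simps)

text \<open>The norm axioms govern real factors only; for complex ones the square of the norm is
  expanded through \<open>cinner_self\<close>.\<close>

lemma norm_scaleC: "norm (scaleC c x) = cmod c * norm x"
proof (rule power2_eq_imp_eq)
  have "complex_of_real ((norm (scaleC c x))\<^sup>2) = (c * cnj c) * complex_of_real ((norm x)\<^sup>2)"
    unfolding cinner_self[symmetric] by (simp add: cinner_scaleC_right cinner_scaleC_left)
  also have "\<dots> = complex_of_real ((cmod c * norm x)\<^sup>2)"
    unfolding complex_norm_square[symmetric] by (simp add: power_mult_distrib)
  finally have "complex_of_real ((norm (scaleC c x))\<^sup>2) = complex_of_real ((cmod c * norm x)\<^sup>2)" .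
  then show "(norm (scaleC c x))\<^sup>2 = (cmod c * norm x)\<^sup>2"
    using of_real_eq_iff by blast
qed auto

text \<open>The discriminant argument behind every Cauchy-Schwarz estimate below: choosing
  \<open>c\<close> as a real multiple of \<open>- cnj \<gamma>\<close> leaves a quadratic in one
  real variable. With \<alpha> = 0 or \<beta> = 0 it forces \<gamma> = 0, which is how variational
  and null-vector arguments use it.\<close>

lemma cauchy_schwarz_from_nonneg:
  fixes \<alpha> \<beta> :: real and \<gamma> :: complex
  assumes "\<And>c. 0 \<le> \<alpha> + 2 * Re (c * \<gamma>) + (cmod c)\<^sup>2 * \<beta>"
  shows "(cmod \<gamma>)\<^sup>2 \<le> \<alpha> * \<beta>"
proof -
  let ?g = "(cmod \<gamma>)\<^sup>2"
  have q: "0 \<le> \<alpha> - 2 * t * ?g + t\<^sup>2 * ?g * \<beta>" for t :: real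
  proof -
    have "Re (- complex_of_real t * cnj \<gamma> * \<gamma>) = - (t * ?g)"
      unfolding cmod_power2 by (simp add: algebra_simps power2_eq_square)
    moreover have "(cmod (- complex_of_real t * cnj \<gamma>))\<^sup>2 = t\<^sup>2 * ?g"
      by (simp add: norm_mult power_mult_distrib)
    ultimately show ?thesis
      using assms[of "- complex_of_real t * cnj \<gamma>"] by simp
  qed
  show ?thesis
  proof (cases "\<gamma> = 0")
    case True
    have "0 \<le> \<alpha>" using assms[of 0] by simp
    have "0 \<le> \<beta>"
    proof (rule ccontr)
      assume n: "\<not> 0 \<le> \<beta>"
      \<comment> \<open>This size of \<open>c\<close> makes the quadratic term equal to -(\<alpha> +
        1), so the whole expression would be -1.\<close>
      define c where "c = complex_of_real (sqrt ((\<alpha> + 1) / - \<beta>))"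
      have "(cmod c)\<^sup>2 = (\<alpha> + 1) / - \<beta>"
        using n \<open>0 \<le> \<alpha>\<close> by (simp add: c_def divide_nonneg_neg)
      then show False using assms[of c] True n by (simp add: field_simps)
    qed
    then show ?thesis using True \<open>0 \<le> \<alpha>\<close> by simp
  next
    case False
    then have g: "?g > 0" by simp
    have b: "\<beta> > 0"
    proof (rule ccontr)
      assume "\<not> \<beta> > 0"
      \<comment> \<open>For nonpositive \<beta> only the linear term matters; here it is 2 *
        (\<bar>\<alpha>\<bar> + 1), which exceeds \<alpha>.\<close>
      define t where "t = (\<bar>\<alpha>\<bar> + 1) / ?g"
      have "t\<^sup>2 * ?g * \<beta> \<le> 0" using \<open>\<not> \<beta> > 0\<close> by (simp add: mult_nonneg_nonpos)
      moreover have "t * ?g = \<bar>\<alpha>\<bar> + 1" using g by (simp add: t_def)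
      ultimately show False using q[of t] by linarith
    qed
    \<comment> \<open>The value t = 1/\<beta> minimises the quadratic \<open>q\<close>.\<close>
    have "0 \<le> \<alpha> - 2 * (1/\<beta>) * ?g + (1/\<beta>)\<^sup>2 * ?g * \<beta>" by (rule q)
    also have "\<dots> = \<alpha> - ?g / \<beta>" using b by (simp add: power2_eq_square field_simps)
    finally show ?thesis using b by (simp add: field_simps)
  qed
qed

lemma norm_cinner_le: "cmod (cinner x y) \<le> norm x * norm y"
proof (rule power2_le_imp_le)
  have "0 \<le> (norm x)\<^sup>2 + 2 * Re (c * cinner x y) + (cmod c)\<^sup>2 * (norm y)\<^sup>2" for c
    using zero_le_power2[of "norm (x + scaleC c y)"]
    by (simp only: power2_norm_add norm_scaleC cinner_scaleC_right power_mult_distrib)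
  then show "(cmod (cinner x y))\<^sup>2 \<le> (norm x * norm y)\<^sup>2"
    using cauchy_schwarz_from_nonneg by (simp add: power_mult_distrib)
qed auto

lemma bounded_linear_cinner_right: "bounded_linear (cinner x)"
  by (rule bounded_linear_intro[where K = "norm x"])
    (use norm_cinner_le in \<open>simp_all add: cinner_simps scaleR_conv_of_real mult.commute[of _ "norm x"]\<close>)

lemma bounded_linear_cinner_left: "bounded_linear (\<lambda>x. cinner x y)"
  by (rule bounded_linear_intro[where K = "norm y"])
    (simp_all add: cinner_simps norm_cinner_le scaleR_conv_of_real)

lemmas tendsto_cinner_right = bounded_linear.tendsto[OF bounded_linear_cinner_right]

lemma cinner_eqI:
  assumes "\<And>z. cinner z x = cinner z y"
  shows "x = y"
proof -
  have "cinner (x - y) (x - y) = 0" using assms[of "x - y"] by (simp add: cinner_diff_right)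
  then show ?thesis by (simp add: cinner_self)
qed

lemma cinner_eqI_dense:
  assumes "closure S = UNIV" and "\<And>z. z \<in> S \<Longrightarrow> cinner z x = cinner z y"
  shows "x = y"
proof (rule cinner_eqI)
  fix z
  have "continuous_on (closure S) (\<lambda>z. cinner z x - cinner z y)"
    by (intro continuous_intros bounded_linear.continuous_on[OF bounded_linear_cinner_left])
  then have "cinner z x - cinner z y = 0"
    by (rule continuous_constant_on_closure) (use assms in auto)
  then show "cinner z x = cinner z y" by simp
qed

section \<open>Bounded operators and their adjoints\<close>

lemma bounded_clinear_bounded_linear: "bounded_clinear a \<Longrightarrow> bounded_linear a"
  by (simp add: bounded_clinear_def)

lemma bounded_clinear_add: "bounded_clinear a \<Longrightarrow> a (x + y) = a x + a y"
  by (simp add: bounded_clinear_def linear_simps)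

lemma bounded_clinear_diff: "bounded_clinear a \<Longrightarrow> a (x - y) = a x - a y"
  by (simp add: bounded_clinear_def linear_simps)

lemma bounded_clinear_scaleC: "bounded_clinear a \<Longrightarrow> a (scaleC c x) = scaleC c (a x)"
  by (simp add: bounded_clinear_def)

lemma bounded_clinear_zero: "bounded_clinear a \<Longrightarrow> a 0 = 0"
  by (simp add: bounded_clinear_def linear_simps)

lemma bounded_clinear_bound:
  assumes "bounded_clinear a"
  obtains K where "K > 0" "\<And>x. norm (a x) \<le> K * norm x"
  using bounded_linear.pos_bounded[OF bounded_clinear_bounded_linear[OF assms]]
  by (auto simp: mult.commute)

lemma bounded_clinearI:
  assumes "\<And>x y. a (x + y) = a x + a y" "\<And>c x. a (scaleC c x) = scaleC c (a x)"
    and "\<And>x. norm (a x) \<le> K * norm x"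
  shows "bounded_clinear a"
  unfolding bounded_clinear_def
  by (intro conjI allI bounded_linear_intro[where K = K])
    (use assms in \<open>simp_all add: scaleR_scaleC mult.commute\<close>)

lemma bounded_clinear_plus:
  "bounded_clinear a \<Longrightarrow> bounded_clinear b \<Longrightarrow> bounded_clinear (\<lambda>x. a x + b x)"
  by (simp add: bounded_clinear_def bounded_linear_add scaleC_add_right)

lemma bounded_clinear_scale: "bounded_clinear a \<Longrightarrow> bounded_clinear (\<lambda>x. scaleC c (a x))"
proof -
  assume a: "bounded_clinear a"
  then obtain K where K: "\<And>x. norm (a x) \<le> K * norm x" using bounded_clinear_bound by metis
  have "cmod c * norm (a x) \<le> cmod c * K * norm x" for x
    using mult_left_mono[OF K, of "cmod c"] by (simp add: mult.assoc)
  then show ?thesis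
    by (intro bounded_clinearI[where K = "cmod c * K"])
      (simp_all add: a bounded_clinear_add bounded_clinear_scaleC scaleC_add_right
        scaleC_scaleC norm_scaleC mult.commute)
qed

lemma bounded_clinear_comp: "bounded_clinear a \<Longrightarrow> bounded_clinear b \<Longrightarrow> bounded_clinear (a \<circ> b)"
  by (simp add: bounded_clinear_def comp_def bounded_linear_compose)

lemma bounded_clinear_id: "bounded_clinear id"
  by (simp add: bounded_clinear_def id_def)

section \<open>The Riesz representation theorem and bounded sesquilinear forms\<close>

lemma parallelogram_law:
  "(norm (x + y))\<^sup>2 + (norm (x - y))\<^sup>2 = 2 * (norm x)\<^sup>2 + 2 * (norm (y::'a::complex_inner))\<^sup>2"
  by (simp add: power2_norm_add power2_norm_diff)

text \<open>The representing vector minimises \<open>J y = (norm y)\<^sup>2 - 2 * Re (f y)\<close>; a minimising sequence is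
  Cauchy by the parallelogram law.\<close>

lemma riesz_representation:
  fixes f :: "'a::chilbert_space \<Rightarrow> complex"
  assumes f: "bounded_linear f" and fc: "\<And>c x. f (scaleC c x) = c * f x"
  shows "\<exists>y. \<forall>x. f x = cinner y x"
proof -
  interpret f: bounded_linear f by fact
  define J where "J y = (norm y)\<^sup>2 - 2 * Re (f y)" for y
  obtain K where K: "\<And>x. cmod (f x) \<le> norm x * K" using f.bounded by blast
  have low: "- K\<^sup>2 \<le> J y" for y
  proof -
    have "Re (f y) \<le> norm y * K" using K[of y] complex_Re_le_cmod[of "f y"] by linarith
    moreover have "0 \<le> (norm y - K)\<^sup>2" by simp
    ultimately show ?thesis by (simp add: J_def power2_diff)
  qed
  define m where "m = Inf (range J)"
  have bdd: "bdd_below (range J)" using low by (rule bdd_belowI2)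
  have mJ: "m \<le> J y" for y unfolding m_def by (rule cInf_lower[OF _ bdd]) simp
  have "\<exists>y. J y < m + inverse (real (Suc n))" for n
    using cInf_lessD[of "range J" "m + inverse (real (Suc n))"] by (auto simp: m_def)
  then obtain u where u: "\<And>n. J (u n) < m + inverse (real (Suc n))" by metis
  \<comment> \<open>The value of \<open>J\<close> at the midpoint is at least \<open>m\<close>; the
    parallelogram law turns this into a bound on the distance.\<close>
  have par: "(norm (y - z))\<^sup>2 \<le> 2 * (J y - m) + 2 * (J z - m)" for y z
  proof -
    have "(norm ((1/2) *\<^sub>R (y + z)))\<^sup>2 = (norm (y + z))\<^sup>2 / 4"
      unfolding norm_scaleR by (simp add: power_mult_distrib power2_eq_square)
    moreover have "f ((1/2) *\<^sub>R (y + z)) = (1/2) *\<^sub>R (f y + f z)"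
      by (simp only: f.scaleR f.add)
    ultimately have "J ((1/2) *\<^sub>R (y + z)) = (norm (y + z))\<^sup>2 / 4 - Re (f y) - Re (f z)"
      unfolding J_def by (simp only:) (simp add: field_simps)
    then show ?thesis
      using mJ[of "(1/2) *\<^sub>R (y + z)"] parallelogram_law[of y z] by (simp add: J_def)
  qed
  have "Cauchy u"
  proof (rule metric_CauchyI)
    fix e :: real assume e: "e > 0"
    then obtain N where N: "inverse (real (Suc N)) < e\<^sup>2 / 4"
      using reals_Archimedean[of "e\<^sup>2 / 4"] by auto
    show "\<exists>N. \<forall>p\<ge>N. \<forall>q\<ge>N. dist (u p) (u q) < e"
    proof (intro exI allI impI)
      fix p q assume pq: "p \<ge> N" "q \<ge> N"
      have "inverse (real (Suc p)) \<le> inverse (real (Suc N))" "inverse (real (Suc q)) \<le> inverse (real (Suc N))"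
        using pq by (auto intro: le_imp_inverse_le)
      then have "J (u p) - m < e\<^sup>2 / 4" "J (u q) - m < e\<^sup>2 / 4"
        using u[of p] u[of q] N by (simp_all only: less_diff_eq add.commute)
      then have "(norm (u p - u q))\<^sup>2 < e\<^sup>2"
        using par[of "u p" "u q"] by argo
      then show "dist (u p) (u q) < e"
        using e by (simp add: dist_norm power_less_imp_less_base)
    qed
  qed
  then obtain y where y: "u \<longlonglongrightarrow> y" by (auto simp: Cauchy_convergent_iff convergent_def)
  have "(\<lambda>n. J (u n)) \<longlonglongrightarrow> J y"
    unfolding J_def by (intro tendsto_intros y f.tendsto)
  moreover have "(\<lambda>n. m + inverse (real (Suc n))) \<longlonglongrightarrow> m + 0"
    by (intro tendsto_intros LIMSEQ_inverse_real_of_nat)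
  ultimately have "J y \<le> m"
    using u by (intro LIMSEQ_le[of _ "J y" _ m]) (auto intro: less_imp_le)
  then have min: "J y \<le> J z" for z using mJ[of z] by linarith
  have "f z = cinner y z" for z
  proof -
    \<comment> \<open>Varying the minimiser by \<open>scaleC c z\<close> gives a quadratic in
      \<open>c\<close> without constant term, so its linear coefficient vanishes.\<close>
    have "0 \<le> 0 + 2 * Re (c * (cinner y z - f z)) + (cmod c)\<^sup>2 * (norm z)\<^sup>2" for c
      using min[of "y + scaleC c z"]
      by (simp add: J_def power2_norm_add f.add fc cinner_scaleC_right norm_scaleC
          power_mult_distrib right_diff_distrib)
    from cauchy_schwarz_from_nonneg[OF this] show ?thesis by simp
  qed
  then show ?thesis by blast
qed

text \<open>Both adjoints and weak limits of operators are built from their matrix coefficients in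
  this way. The form is antilinear in its first argument, so Riesz is applied to its conjugate
  there.\<close>

lemma operator_of_sesquilinear_form:
  fixes c :: "'h::chilbert_space \<Rightarrow> 'h \<Rightarrow> complex"
  assumes add_left: "\<And>x y z. c (x + y) z = c x z + c y z"
    and scale_left: "\<And>k x z. c (scaleC k x) z = cnj k * c x z"
    and add_right: "\<And>x y z. c x (y + z) = c x y + c x z"
    and scale_right: "\<And>k x z. c x (scaleC k z) = k * c x z"
    and bound: "\<And>x y. cmod (c x y) \<le> C * norm x * norm y"
  obtains a where "a \<in> bounded_ops" "\<And>x y. cinner x (a y) = c x y"
proof -
  have "\<exists>v. \<forall>x. cnj (c x y) = cinner v x" for y
  proof (rule riesz_representation)
    show "bounded_linear (\<lambda>x. cnj (c x y))"
      by (rule bounded_linear_intro[where K = "C * norm y"])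
        (use bound[of _ y] in \<open>auto simp: add_left scaleR_scaleC scale_left scaleR_conv_of_real ac_simps\<close>)
  qed (simp add: scale_left)
  then obtain a where "\<And>y x. cnj (c x y) = cinner (a y) x" by metis
  then have a: "cinner x (a y) = c x y" for x y
    by (metis cinner_commute complex_cnj_cnj)
  have "norm (a y) \<le> C * norm y" for y
  proof (cases "a y = 0")
    case True
    show ?thesis
    proof (cases "y = 0")
      case False
      \<comment> \<open>The sign of \<open>C\<close> is read off from the bound at the pair (y,
        y).\<close>
      then have "0 \<le> C * norm y * norm y" using bound[of y y] norm_ge_zero order_trans by blast
      then show ?thesis using True False by (simp add: zero_le_mult_iff)
    qed (use True in simp)
  next
    case False
    have "(norm (a y))\<^sup>2 = cmod (cinner (a y) (a y))" by (simp add: cinner_self norm_power)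
    also have "\<dots> \<le> C * norm (a y) * norm y" unfolding a by (rule bound)
    finally show ?thesis using False by (simp add: power2_eq_square mult.assoc mult.left_commute)
  qed
  moreover have "a (x + y) = a x + a y" for x y
    by (rule cinner_eqI) (simp add: a add_right cinner_add_right)
  moreover have "a (scaleC k x) = scaleC k (a x)" for k x
    by (rule cinner_eqI) (simp add: a scale_right cinner_scaleC_right)
  ultimately have "bounded_clinear a"
    by (intro bounded_clinearI[where K = C])
  then show ?thesis using a that by (simp add: bounded_ops_def)
qed

section \<open>Adjoints of bounded operators\<close>

lemma cadjoint_eqI:
  assumes "\<And>x y. cinner (a x) y = cinner x (b y)"
  shows "cadjoint a = b"
  unfolding cadjoint_def
proof (rule the_equality)
  show "\<forall>x y. cinner (a x) y = cinner x (b y)" using assms by blast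
  show "d = b" if "\<forall>x y. cinner (a x) y = cinner x (d y)" for d
  proof
    show "d y = b y" for y by (rule cinner_eqI) (use assms that in metis)
  qed
qed

lemma cadjoint_props:
  fixes a :: "'h::chilbert_space \<Rightarrow> 'h"
  assumes a: "a \<in> bounded_ops"
  shows "cadjoint a \<in> bounded_ops" "\<And>x y. cinner (a x) y = cinner x (cadjoint a y)"
proof -
  have ac: "bounded_clinear a" using a by (simp add: bounded_ops_def)
  obtain K where K: "K > 0" "\<And>x. norm (a x) \<le> K * norm x"
    using bounded_clinear_bound[OF ac] by blast
  have bd: "cmod (cinner (a x) y) \<le> K * norm x * norm y" for x y
    by (rule order_trans[OF norm_cinner_le]) (simp add: K mult_right_mono)
  obtain b where b: "b \<in> bounded_ops" "\<And>x y. cinner x (b y) = cinner (a x) y"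
    by (rule operator_of_sesquilinear_form[of "\<lambda>x y. cinner (a x) y" K])
      (use bd in \<open>auto simp: ac bounded_clinear_add bounded_clinear_scaleC cinner_simps\<close>)
  have "cadjoint a = b" by (rule cadjoint_eqI) (simp add: b)
  then show "cadjoint a \<in> bounded_ops" "\<And>x y. cinner (a x) y = cinner x (cadjoint a y)"
    using b by auto
qed

lemma cinner_cadjoint: "a \<in> bounded_ops \<Longrightarrow> cinner x (cadjoint a y) = cinner (a x) y"
  by (simp add: cadjoint_props)

lemma cinner_cadjoint': "a \<in> bounded_ops \<Longrightarrow> cinner (cadjoint a x) y = cinner x (a y)"
  by (metis cadjoint_props(2) cinner_commute)

lemma cadjoint_cadjoint: "a \<in> bounded_ops \<Longrightarrow> cadjoint (cadjoint a) = a"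
  by (rule cadjoint_eqI) (rule cinner_cadjoint')

lemma cadjoint_comp:
  "a \<in> bounded_ops \<Longrightarrow> b \<in> bounded_ops \<Longrightarrow> cadjoint (a \<circ> b) = cadjoint b \<circ> cadjoint a"
  by (rule cadjoint_eqI) (simp add: cadjoint_props)

lemma cadjoint_plus:
  "a \<in> bounded_ops \<Longrightarrow> b \<in> bounded_ops \<Longrightarrow>
    cadjoint (\<lambda>x. a x + b x) = (\<lambda>x. cadjoint a x + cadjoint b x)"
  by (rule cadjoint_eqI) (simp add: cadjoint_props cinner_simps)

lemma cadjoint_scale:
  "a \<in> bounded_ops \<Longrightarrow> cadjoint (\<lambda>x. scaleC c (a x)) = (\<lambda>x. scaleC (cnj c) (cadjoint a x))"
  by (rule cadjoint_eqI) (simp add: cadjoint_props cinner_simps)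

lemma
  shows bounded_ops_plus: "a \<in> bounded_ops \<Longrightarrow> b \<in> bounded_ops \<Longrightarrow> (\<lambda>x. a x + b x) \<in> bounded_ops"
    and bounded_ops_scale: "a \<in> bounded_ops \<Longrightarrow> (\<lambda>x. scaleC c (a x)) \<in> bounded_ops"
    and bounded_ops_comp: "a \<in> bounded_ops \<Longrightarrow> b \<in> bounded_ops \<Longrightarrow> a \<circ> b \<in> bounded_ops"
    and bounded_ops_id: "id \<in> bounded_ops"
  by (simp_all add: bounded_ops_def bounded_clinear_plus bounded_clinear_scale
      bounded_clinear_comp bounded_clinear_id)

lemma bounded_ops_minus:
  assumes "a \<in> bounded_ops" "b \<in> bounded_ops"
  shows "(\<lambda>x. a x - b x) \<in> bounded_ops"
  using bounded_ops_plus[OF assms(1) bounded_ops_scale[OF assms(2), of "-1"]]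
  by (simp add: scaleC_minus_one)

text \<open>Complex polarisation: the form at x + y makes the sum of the two mixed terms vanish, and
  replacing x by \<open>scaleC \<i> x\<close> makes their difference vanish.\<close>

lemma zero_form_imp_zero:
  assumes a: "bounded_clinear a" and z: "\<And>x. cinner x (a x) = 0"
  shows "a = (\<lambda>x. 0)"
proof
  fix y
  have "cinner x (a y) = 0" for x
  proof -
    have 1: "cinner x (a y) + cinner y (a x) = 0" for x
      using z[of "x + y"] z[of x] z[of y] by (simp add: bounded_clinear_add[OF a] cinner_simps add.commute)
    have "- \<i> * cinner x (a y) + \<i> * cinner y (a x) = 0"
      using 1[of "scaleC \<i> x"] by (simp add: bounded_clinear_scaleC[OF a] cinner_simps)
    then have "\<i> * (cinner y (a x) - cinner x (a y)) = 0" by (simp add: algebra_simps)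
    then have "cinner y (a x) = cinner x (a y)" by simp
    then show ?thesis using 1[of x] by simp
  qed
  then show "a y = 0" by (intro cinner_eqI) simp
qed

lemma real_form_imp_cadjoint_eq:
  assumes a: "a \<in> bounded_ops" and r: "\<And>x. cinner x (a x) \<in> \<real>"
  shows "cadjoint a = a"
proof -
  have "(\<lambda>x. cadjoint a x - a x) = (\<lambda>x. 0)"
  proof (rule zero_form_imp_zero)
    show "bounded_clinear (\<lambda>x. cadjoint a x - a x)"
      using bounded_ops_minus[OF cadjoint_props(1)[OF a] a] by (simp add: bounded_ops_def)
    fix x
    have "cinner x (cadjoint a x) = cnj (cinner x (a x))"
      by (metis cinner_cadjoint[OF a] cinner_commute)
    then show "cinner x (cadjoint a x - a x) = 0"
      using r[of x] by (simp add: cinner_simps Reals_cnj_iff)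
  qed
  then show ?thesis by (metis diff_0_right diff_eq_diff_eq ext)
qed

lemma positive_op_cadjoint: "positive_op a \<Longrightarrow> cadjoint a = a"
  by (rule real_form_imp_cadjoint_eq)
    (simp_all add: positive_op_def complex_nonneg_Reals_iff complex_is_Real_iff)

section \<open>Von Neumann algebras and ultraweak limits\<close>

lemma von_neumann_algebra_bounded_ops:
  "von_neumann_algebra M \<Longrightarrow> a \<in> M \<Longrightarrow> a \<in> bounded_ops"
  by (auto simp: von_neumann_algebra_def)

lemma von_neumann_algebra_bounded_clinear:
  "von_neumann_algebra M \<Longrightarrow> a \<in> M \<Longrightarrow> bounded_clinear a"
  using von_neumann_algebra_bounded_ops by (auto simp: bounded_ops_def)

lemma von_neumann_algebra_cadjoint: "von_neumann_algebra M \<Longrightarrow> a \<in> M \<Longrightarrow> cadjoint a \<in> M"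
  by (simp add: von_neumann_algebra_def)

text \<open>The bicommutant condition spelled out on vectors. Closure under the algebra operations
  and under weak limits both reduce to commuting with each \<open>b\<close> that commutes with
  \<open>M\<close>.\<close>

lemma von_neumann_algebra_memI:
  assumes "von_neumann_algebra M" "a \<in> bounded_ops"
    and "\<And>b x. b \<in> bounded_ops \<Longrightarrow> (\<And>c y. c \<in> M \<Longrightarrow> c (b y) = b (c y)) \<Longrightarrow> a (b x) = b (a x)"
  shows "a \<in> M"
proof -
  have "b \<circ> a = a \<circ> b" if "b \<in> commutant M" for b
  proof
    have "b \<in> bounded_ops" "\<And>c. c \<in> M \<Longrightarrow> c \<circ> b = b \<circ> c" using that by (auto simp: commutant_def)
    then show "(b \<circ> a) x = (a \<circ> b) x" for x using assms(3)[of b x] by (metis comp_apply)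
  qed
  then have "a \<in> commutant (commutant M)" using assms(2) by (simp add: commutant_def)
  then show ?thesis using assms(1) by (simp add: von_neumann_algebra_def)
qed

lemma von_neumann_algebra_plus:
  assumes M: "von_neumann_algebra M" and "a \<in> M" "b \<in> M"
  shows "(\<lambda>x. a x + b x) \<in> M"
proof (rule von_neumann_algebra_memI[OF M])
  show "(\<lambda>x. a x + b x) \<in> bounded_ops"
    by (intro bounded_ops_plus von_neumann_algebra_bounded_ops[OF M] assms)
qed (simp add: assms bounded_ops_def bounded_clinear_add)

lemma von_neumann_algebra_scale:
  assumes M: "von_neumann_algebra M" and "a \<in> M"
  shows "(\<lambda>x. scaleC c (a x)) \<in> M"
proof (rule von_neumann_algebra_memI[OF M])
  show "(\<lambda>x. scaleC c (a x)) \<in> bounded_ops"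
    by (intro bounded_ops_scale von_neumann_algebra_bounded_ops[OF M] assms)
qed (simp add: assms bounded_ops_def bounded_clinear_scaleC)

lemma von_neumann_algebra_comp:
  assumes M: "von_neumann_algebra M" and "a \<in> M" "b \<in> M"
  shows "a \<circ> b \<in> M"
proof (rule von_neumann_algebra_memI[OF M])
  show "a \<circ> b \<in> bounded_ops"
    by (intro bounded_ops_comp von_neumann_algebra_bounded_ops[OF M] assms)
qed (simp add: assms)

lemma von_neumann_algebra_id: "von_neumann_algebra M \<Longrightarrow> id \<in> M"
  by (rule von_neumann_algebra_memI) (simp_all add: bounded_ops_id)

lemma von_neumann_algebra_zero: "von_neumann_algebra M \<Longrightarrow> (\<lambda>x. 0) \<in> M"
  using von_neumann_algebra_scale[OF _ von_neumann_algebra_id, of M 0] by simp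

lemma von_neumann_algebra_minus:
  "von_neumann_algebra M \<Longrightarrow> a \<in> M \<Longrightarrow> b \<in> M \<Longrightarrow> (\<lambda>x. a x - b x) \<in> M"
  using von_neumann_algebra_plus[OF _ _ von_neumann_algebra_scale[of M b "-1"], of a]
  by (simp add: scaleC_minus_one)

lemmas von_neumann_algebra_closed = von_neumann_algebra_plus von_neumann_algebra_scale
  von_neumann_algebra_comp von_neumann_algebra_id von_neumann_algebra_minus
  von_neumann_algebra_zero von_neumann_algebra_cadjoint

section \<open>Ultraweak convergence and weak cluster points\<close>

text \<open>Open sets arise from the generators by finite intersections and arbitrary unions, and
  eventual membership passes through both.\<close>

lemma limitin_topology_generated_byI:
  assumes "l \<in> \<Union>S" and "\<And>U. U \<in> S \<Longrightarrow> l \<in> U \<Longrightarrow> eventually (\<lambda>n. x n \<in> U) F"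
  shows "limitin (topology_generated_by S) x l F"
proof -
  have "l \<in> U \<longrightarrow> eventually (\<lambda>n. x n \<in> U) F" if "generate_topology_on S U" for U
    using that
  proof induction
    case (Int a b)
    then show ?case by (auto elim: eventually_elim2)
  next
    case (UN K)
    show ?case
    proof
      assume "l \<in> \<Union>K"
      then obtain k where "k \<in> K" "l \<in> k" by blast
      then have "eventually (\<lambda>n. x n \<in> k) F" using UN by blast
      then show "eventually (\<lambda>n. x n \<in> \<Union>K) F" by eventually_elim (use \<open>k \<in> K\<close> in blast)
    qed
  qed (use assms in auto)
  then show ?thesis using assms(1) by (auto simp: limitin_def openin_topology_generated_by_iff)
qed

lemma summable_norm_mult:
  assumes "summable (\<lambda>n. (norm (x n))\<^sup>2)" "summable (\<lambda>n. (norm (y n))\<^sup>2)"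
  shows "summable (\<lambda>n. norm (x n) * norm (y n))"
proof (rule summable_comparison_test'[OF summable_add[OF assms]])
  fix n
  have "2 * (norm (x n) * norm (y n)) \<le> (norm (x n))\<^sup>2 + (norm (y n))\<^sup>2"
    using zero_le_power2[of "norm (x n) - norm (y n)"] by (simp add: power2_diff)
  moreover have "0 \<le> norm (x n) * norm (y n)" by simp
  moreover have "norm (norm (x n) * norm (y n)) = norm (x n) * norm (y n)" by simp
  ultimately show "norm (norm (x n) * norm (y n)) \<le> (norm (x n))\<^sup>2 + (norm (y n))\<^sup>2"
    by linarith
qed

text \<open>On norm-bounded families weak and ultraweak convergence agree: the series defining an
  ultraweak functional are dominated by C times the summable products of norms, so Tannery's theorem
  takes the limit termwise.\<close>

lemma limitin_ultraweakI:
  assumes M: "M \<subseteq> bounded_ops" and x: "\<And>n. x n \<in> M"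
    and bd: "\<And>n v. norm (x n v) \<le> C * norm v" and l: "l \<in> M"
    and lim: "\<And>u v. ((\<lambda>n. cinner u (x n v)) \<longlongrightarrow> cinner u (l v)) F"
  shows "limitin (ultraweak_on M) x l F"
proof -
  have "limitin ultraweak_topology x l F"
    unfolding ultraweak_topology_def
  proof (rule limitin_topology_generated_byI)
    let ?S = "{{a \<in> bounded_ops. (\<Sum>n. cinner (u n) (a (v n))) \<in> V} |u v V.
        summable (\<lambda>n::nat. (norm (u n))\<^sup>2) \<and> summable (\<lambda>n. (norm (v n))\<^sup>2) \<and> open V}"
    \<comment> \<open>Zero sequences and V = UNIV give a generator containing all bounded operators,
      which places \<open>l\<close> in the underlying space.\<close>
    have "{a \<in> bounded_ops. (\<Sum>n. cinner ((\<lambda>n. 0) n) (a ((\<lambda>n. 0) n))) \<in> UNIV} \<in> ?S"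
      by (rule CollectI, rule exI[of _ "\<lambda>n. 0"], rule exI[of _ "\<lambda>n. 0"], rule exI[of _ UNIV]) auto
    then show "l \<in> \<Union>?S" using l M by blast
    fix U assume "U \<in> ?S" and lU: "l \<in> U"
    then obtain u v :: "nat \<Rightarrow> 'a" and V
      where U: "U = {a \<in> bounded_ops. (\<Sum>n. cinner (u n) (a (v n))) \<in> V}"
      and s: "summable (\<lambda>n. (norm (u n))\<^sup>2)" "summable (\<lambda>n. (norm (v n))\<^sup>2)" and V: "open V"
      by blast
    show "eventually (\<lambda>n. x n \<in> U) F"
    \<comment> \<open>Tannery's theorem needs a proper filter; along \<open>bot\<close> everything
      holds eventually.\<close>
    proof (cases "F = bot")
      case False
      have "((\<lambda>n. \<Sum>k. cinner (u k) (x n (v k))) \<longlongrightarrow> (\<Sum>k. cinner (u k) (l (v k)))) F"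
      proof (rule tannerys_theorem[THEN conjunct2, THEN conjunct2])
        show "\<And>k. ((\<lambda>n. cinner (u k) (x n (v k))) \<longlongrightarrow> cinner (u k) (l (v k))) F" by (rule lim)
        show "summable (\<lambda>k. C * (norm (u k) * norm (v k)))"
          by (intro summable_mult summable_norm_mult s)
        have "norm (cinner (u k) (x n (v k))) \<le> C * (norm (u k) * norm (v k))" for k n
          using norm_cinner_le[of "u k" "x n (v k)"] mult_left_mono[OF bd[of n "v k"], of "norm (u k)"]
          by (simp add: algebra_simps)
        then show "eventually (\<lambda>(k,n). norm (cinner (u k) (x n (v k))) \<le> C * (norm (u k) * norm (v k)))
            (at_top \<times>\<^sub>F F)" by (intro always_eventually) auto
      qed fact
      then have "eventually (\<lambda>n. (\<Sum>k. cinner (u k) (x n (v k))) \<in> V) F"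
        using V lU topological_tendstoD[of _ _ F V] by (auto simp: U)
      then show ?thesis by eventually_elim (use x M in \<open>auto simp: U\<close>)
    qed simp
  qed
  then show ?thesis using l x by (simp add: limitin_subtopology)
qed

text \<open>A matrix coefficient is an ultraweak functional: the sequences \<open>p u\<close> and
  \<open>p v\<close> live at index 0 only, so the series has a single term.\<close>

lemma limitin_ultraweak_imp_weak:
  assumes "limitin (ultraweak_on M) x l F"
  shows "((\<lambda>n. cinner u (x n v)) \<longlongrightarrow> cinner u (l v)) F"
proof (rule topological_tendstoI)
  fix V assume V: "open V" "cinner u (l v) \<in> V"
  define p where "p w k = (if k = (0::nat) then w else 0)" for w :: 'a and k
  have sum: "(\<Sum>k. cinner (p u k) (a (p v k))) = cinner u (a v)" for a
    using suminf_finite[of "{0}" "\<lambda>k. cinner (p u k) (a (p v k))"] by (simp add: p_def)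
  have p: "summable (\<lambda>k. (norm (p w k))\<^sup>2)" for w
    by (rule summable_finite[of "{0}"]) (auto simp: p_def)
  let ?U = "{a \<in> bounded_ops. (\<Sum>k. cinner (p u k) (a (p v k))) \<in> V}"
  have "openin ultraweak_topology ?U"
    unfolding ultraweak_topology_def
    by (rule topology_generated_by_Basis) (use V p in blast)
  moreover have lim: "limitin ultraweak_topology x l F"
    using assms by (simp add: limitin_subtopology)
  moreover have "l \<in> bounded_ops"
    using limitin_topspace[OF lim] by (auto simp: ultraweak_topology_def)
  then have "l \<in> ?U" using V by (simp add: sum)
  ultimately have "eventually (\<lambda>n. x n \<in> ?U) F" by (auto simp: limitin_def)
  then show "eventually (\<lambda>n. cinner u (x n v) \<in> V) F"
    by eventually_elim (simp add: sum)
qed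

text \<open>Tychonoff's theorem makes the matrix coefficients of the sequence cluster simultaneously.\<close>

lemma bounded_sequence_weak_cluster_point:
  fixes x :: "nat \<Rightarrow> 'h::chilbert_space \<Rightarrow> 'h"
  assumes M: "von_neumann_algebra M" and x: "\<And>n. x n \<in> M"
    and bd: "\<And>n v. norm (x n v) \<le> C * norm v"
  obtains F l where "F \<noteq> bot" "F \<le> sequentially" "l \<in> M"
    "\<And>u v. ((\<lambda>n. cinner u (x n v)) \<longlongrightarrow> cinner u (l v)) F"
proof -
  define z where "z n = (\<lambda>(u, v). cinner u (x n v))" for n
  define K where "K = PiE UNIV (\<lambda>(u::'h, v::'h). cball (0::complex) (C * norm u * norm v))"
  have zb: "cmod (cinner u (x n v)) \<le> C * norm u * norm v" for u v n
    using norm_cinner_le[of u "x n v"] mult_left_mono[OF bd[of n v], of "norm u"]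
    by (simp add: algebra_simps)
  have "compactin (product_topology (\<lambda>_. euclidean) UNIV) K"
    unfolding K_def compactin_PiE by (auto simp: compactin_euclidean_iff)
  then have "compact K"
    by (simp add: euclidean_product_topology compactin_euclidean_iff)
  moreover have "eventually (\<lambda>w. w \<in> K) (filtermap z sequentially)"
    unfolding eventually_filtermap by (intro always_eventually) (auto simp: K_def z_def zb)
  moreover have "filtermap z sequentially \<noteq> bot" by (simp add: filtermap_bot_iff)
  ultimately obtain k where k: "inf (nhds k) (filtermap z sequentially) \<noteq> bot"
    unfolding compact_filter by blast
  \<comment> \<open>\<open>F\<close> plays the role of a subnet on which the coefficients converge
    to \<open>k\<close>: compactness of this product yields cluster points rather than convergent
    subsequences.\<close>
  define F where "F = inf (filtercomap z (nhds k)) sequentially"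
  have F: "F \<noteq> bot"
  proof
    assume "F = bot"
    then have "eventually (\<lambda>n. False) F" by simp
    then obtain P Q where PQ: "eventually P (filtercomap z (nhds k))" "eventually Q sequentially"
      "\<And>n. P n \<Longrightarrow> Q n \<Longrightarrow> False"
      unfolding F_def eventually_inf by blast
    obtain R where R: "eventually R (nhds k)" "\<And>n. R (z n) \<Longrightarrow> P n"
      using PQ(1) unfolding eventually_filtercomap by blast
    have "eventually (\<lambda>w. \<not> R w) (filtermap z sequentially)"
      unfolding eventually_filtermap using PQ(2) by eventually_elim (use R PQ(3) in blast)
    then have "eventually (\<lambda>w. False) (inf (nhds k) (filtermap z sequentially))"
      unfolding eventually_inf using R(1) by blast
    then show False using k by (simp add: trivial_limit_def)
  qed
  have zk: "(z \<longlongrightarrow> k) F"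
    unfolding F_def filterlim_def
    by (rule order_trans[OF filtermap_mono[OF inf_le1]]) (rule filtermap_filtercomap)
  have lim: "((\<lambda>n. cinner u (x n v)) \<longlongrightarrow> k (u, v)) F" for u v
    using continuous_on_tendsto_compose[OF continuous_on_product_coordinates[of "(u, v)"] zk]
    by (simp add: z_def)
  have xc: "bounded_clinear (x n)" for n
    using x von_neumann_algebra_bounded_clinear[OF M] by blast
  note uniq = tendsto_unique[OF F lim]
  obtain l where l: "l \<in> bounded_ops" "\<And>u v. cinner u (l v) = k (u, v)"
  proof (rule operator_of_sesquilinear_form[of "\<lambda>u v. k (u, v)" C])
    show "k (u + u', v) = k (u, v) + k (u', v)" for u u' v
      using tendsto_add[OF lim[of u v] lim[of u' v]] by (intro uniq) (simp add: cinner_simps)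
    show "k (scaleC c u, v) = cnj c * k (u, v)" for c u v
      using tendsto_mult_left[OF lim[of u v], of "cnj c"] by (intro uniq) (simp add: cinner_simps)
    show "k (u, v + v') = k (u, v) + k (u, v')" for u v v'
      using tendsto_add[OF lim[of u v] lim[of u v']]
      by (intro uniq) (simp add: cinner_simps bounded_clinear_add[OF xc])
    show "k (u, scaleC c v) = c * k (u, v)" for c u v
      using tendsto_mult_left[OF lim[of u v], of c]
      by (intro uniq) (simp add: cinner_simps bounded_clinear_scaleC[OF xc])
    show "cmod (k (u, v)) \<le> C * norm u * norm v" for u v
      by (rule tendsto_upperbound[OF tendsto_norm[OF lim[of u v]] _ F])
        (simp add: zb)
  qed blast
  have "l \<in> M"
  proof (rule von_neumann_algebra_memI[OF M l(1)])
    fix b v assume b: "b \<in> bounded_ops" "\<And>c y. c \<in> M \<Longrightarrow> c (b y) = b (c y)"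
    show "l (b v) = b (l v)"
    proof (rule cinner_eqI)
      fix u
      \<comment> \<open>Moving \<open>b\<close> to the left entry as its adjoint keeps everything a
        matrix coefficient of \<open>x n\<close>, so commutation survives the weak limit.\<close>
      have "cinner u (l (b v)) = cinner (cadjoint b u) (l v)"
        unfolding l(2)
      proof (rule uniq)
        show "((\<lambda>n. cinner u (x n (b v))) \<longlongrightarrow> k (cadjoint b u, v)) F"
          using lim[of "cadjoint b u" v] by (simp add: b x cinner_cadjoint')
      qed
      then show "cinner u (l (b v)) = cinner u (b (l v))" by (simp add: b cinner_cadjoint')
    qed
  qed
  then show ?thesis using that[OF F] lim l(2) by (simp add: F_def)
qed

section \<open>Schwartz maps\<close>

lemma norm_cadjoint_le:
  assumes a: "a \<in> bounded_ops" and C: "\<And>x. norm (a x) \<le> C * norm x"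
  shows "norm (cadjoint a x) \<le> C * norm x"
proof (cases "cadjoint a x = 0")
  case True
  then show ?thesis using order_trans[OF norm_ge_zero C[of x]] by simp
next
  case False
  have "(norm (cadjoint a x))\<^sup>2 = Re (cinner (a (cadjoint a x)) x)"
    by (simp add: power2_norm_eq_Re_cinner cinner_cadjoint[OF a])
  also have "\<dots> \<le> norm (a (cadjoint a x)) * norm x"
    using complex_Re_le_cmod norm_cinner_le order_trans by blast
  also have "\<dots> \<le> (C * norm (cadjoint a x)) * norm x"
    by (intro mult_right_mono C) simp
  finally show ?thesis using False by (simp add: power2_eq_square mult.assoc mult.left_commute)
qed

lemma bounded_ops_form_ext:
  assumes "a \<in> bounded_ops" "b \<in> bounded_ops" and "\<And>x. cinner x (a x) = cinner x (b x)"
  shows "a = b"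
proof -
  have "(\<lambda>x. a x - b x) = (\<lambda>x. 0)"
    using bounded_ops_minus[OF assms(1,2)]
    by (intro zero_form_imp_zero) (simp_all add: bounded_ops_def assms(3) cinner_diff_right)
  then show ?thesis by (metis eq_iff_diff_eq_0 ext)
qed

lemma positive_op_iff:
  "positive_op a \<longleftrightarrow> a \<in> bounded_ops \<and> (\<forall>x. 0 \<le> Re (cinner x (a x)) \<and> Im (cinner x (a x)) = 0)"
  by (simp add: positive_op_def complex_nonneg_Reals_iff)

text \<open>Cauchy-Schwarz for the semidefinite form of \<open>g\<close>, applied to
  \<open>g x\<close> and \<open>x\<close>, bounds the fourth power of \<open>norm (g x)\<close> by
  the product of the form at \<open>g x\<close> and the form at \<open>x\<close>.\<close>

lemma positive_op_norm_le:
  assumes g: "positive_op g" and le: "\<And>x. Re (cinner x (g x)) \<le> (norm x)\<^sup>2"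
  shows "norm (g x) \<le> norm x"
proof -
  have gb: "g \<in> bounded_ops" and gc: "bounded_clinear g" using g by (auto simp: positive_op_def bounded_ops_def)
  have ga: "cinner u (g v) = cinner (g u) v" for u v
    using cadjoint_props(2)[OF gb] positive_op_cadjoint[OF g] by simp
  let ?y = "g x"
  have "0 \<le> Re (cinner ?y (g ?y)) + 2 * Re (c * cinner ?y (g x)) + (cmod c)\<^sup>2 * Re (cinner x (g x))" for c
  proof -
    have "0 \<le> Re (cinner (?y + scaleC c x) (g (?y + scaleC c x)))"
      using g by (simp add: positive_op_iff)
    also have "\<dots> = Re (cinner ?y (g ?y)) + (Re (c * cinner ?y (g x)) + Re (cnj c * cinner x (g ?y)))
        + Re (c * cnj c * cinner x (g x))"
      by (simp add: bounded_clinear_add[OF gc] bounded_clinear_scaleC[OF gc] cinner_simps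
          del: times_complex.sel)
        (simp add: algebra_simps)
    also have "Re (cnj c * cinner x (g ?y)) = Re (c * cinner ?y (g x))"
      by (subst ga, subst cinner_commute) simp
    also have "Re (c * cnj c * cinner x (g x)) = (cmod c)\<^sup>2 * Re (cinner x (g x))"
      unfolding complex_norm_square[symmetric] by simp
    finally show ?thesis by simp
  qed
  from cauchy_schwarz_from_nonneg[OF this]
  have "(cmod (cinner ?y ?y))\<^sup>2 \<le> Re (cinner ?y (g ?y)) * Re (cinner x (g x))" .
  also have "\<dots> \<le> (norm ?y)\<^sup>2 * (norm x)\<^sup>2"
    by (intro mult_mono le) (use g in \<open>auto simp: positive_op_iff\<close>)
  moreover have "cmod (cinner ?y ?y) = (norm ?y)\<^sup>2" by (simp only: cinner_self norm_of_real) simp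
  ultimately have *: "(norm ?y)\<^sup>2 * (norm ?y)\<^sup>2 \<le> (norm ?y)\<^sup>2 * (norm x)\<^sup>2"
    by (simp only: power2_eq_square)
  show ?thesis
  proof (cases "?y = 0")
    case False
    then have "(norm ?y)\<^sup>2 \<le> (norm x)\<^sup>2" using mult_le_cancel_left_pos[THEN iffD1, OF _ *] by simp
    then show ?thesis by (rule power2_le_imp_le) simp
  qed simp
qed

lemma op_le_trans:
  assumes "op_le a b" "op_le b c"
  shows "op_le a c"
proof -
  have "(\<lambda>x. (b x - a x) + (c x - b x)) \<in> bounded_ops"
    using assms by (intro bounded_ops_plus) (auto simp: op_le_def positive_op_def)
  then have "(\<lambda>x. c x - a x) \<in> bounded_ops" by simp
  then show ?thesis
    using assms by (auto simp: op_le_def positive_op_iff cinner_diff_right intro: order_trans)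
qed

lemma cadjoint_comp_positive:
  assumes a: "a \<in> bounded_ops"
  shows "positive_op (cadjoint a \<circ> a)"
  using bounded_ops_comp[OF cadjoint_props(1)[OF a] a]
  by (simp add: positive_op_iff cinner_cadjoint[OF a] cinner_self)

section \<open>Linearity and compatibility with adjoints\<close>

lemma schwartz_map_closed: "unital_schwartz_map M \<Phi> \<Longrightarrow> a \<in> M \<Longrightarrow> \<Phi> a \<in> M"
  by (simp add: unital_schwartz_map_def)

lemma schwartz_map_plus:
  "unital_schwartz_map M \<Phi> \<Longrightarrow> a \<in> M \<Longrightarrow> b \<in> M \<Longrightarrow> \<Phi> (\<lambda>x. a x + b x) = (\<lambda>x. \<Phi> a x + \<Phi> b x)"
  by (simp add: unital_schwartz_map_def linear_map_on_def)

lemma schwartz_map_scale: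
  "unital_schwartz_map M \<Phi> \<Longrightarrow> a \<in> M \<Longrightarrow> \<Phi> (\<lambda>x. scaleC c (a x)) = (\<lambda>x. scaleC c (\<Phi> a x))"
  by (simp add: unital_schwartz_map_def linear_map_on_def)

lemma schwartz_map_id: "unital_schwartz_map M \<Phi> \<Longrightarrow> \<Phi> id = id"
  by (simp add: unital_schwartz_map_def)

lemma schwartz_map_minus:
  assumes "von_neumann_algebra M" "unital_schwartz_map M \<Phi>" "a \<in> M" "b \<in> M"
  shows "\<Phi> (\<lambda>x. a x - b x) = (\<lambda>x. \<Phi> a x - \<Phi> b x)"
  using schwartz_map_plus[OF assms(2,3) von_neumann_algebra_scale[OF assms(1,4), of "-1"]]
    schwartz_map_scale[OF assms(2,4), of "-1"]
  by (simp add: scaleC_minus_one)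

text \<open>Positivity of \<open>\<Phi> (cadjoint b) \<circ> \<Phi> b\<close> makes its quadratic
  form real. For b = a + c with a scalar \<open>c\<close>, reality of the cross terms ties
  \<open>\<Phi> (cadjoint a)\<close> to the adjoint of \<open>\<Phi> a\<close>.\<close>

lemma schwartz_map_cadjoint:
  fixes M :: "('h::chilbert_space \<Rightarrow> 'h) set"
  assumes M: "von_neumann_algebra M" and S: "unital_schwartz_map M \<Phi>" and a: "a \<in> M"
  shows "\<Phi> (cadjoint a) = cadjoint (\<Phi> a)"
proof -
  note ops = von_neumann_algebra_bounded_ops[OF M]
  let ?p = "\<Phi> a" and ?q = "\<Phi> (cadjoint a)"
  have aM: "cadjoint a \<in> M" by (rule von_neumann_algebra_cadjoint[OF M a])
  have p: "?p \<in> bounded_ops" and q: "?q \<in> bounded_ops"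
    using ops schwartz_map_closed[OF S] a aM by blast+
  have qc: "bounded_clinear ?q" using q by (simp add: bounded_ops_def)
  have id: "(\<lambda>x. x) \<in> M" using von_neumann_algebra_id[OF M] by (simp add: id_def)
  have sc: "\<Phi> (\<lambda>x. scaleC c x) = (\<lambda>x. scaleC c x)" for c
    using schwartz_map_scale[OF S von_neumann_algebra_id[OF M], of c] schwartz_map_id[OF S] by simp
  have scM: "(\<lambda>x. scaleC c x) \<in> M" for c using von_neumann_algebra_scale[OF M id] by simp
  have real: "Im (cinner v (\<Phi> (cadjoint b) (\<Phi> b v))) = 0" if "b \<in> M" for b v
    using S that by (auto simp: unital_schwartz_map_def op_le_def positive_op_iff)
  have im: "Im (cinner v (scaleC c (?q v)) + cinner v (scaleC (cnj c) (?p v))) = 0" for c v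
  proof -
    let ?b = "\<lambda>x. a x + scaleC c x"
    have "cadjoint (\<lambda>x::'h. scaleC c x) = (\<lambda>x. scaleC (cnj c) x)"
      by (rule cadjoint_eqI) (simp add: cinner_simps)
    then have "cadjoint ?b = (\<lambda>x. cadjoint a x + scaleC (cnj c) x)"
      by (simp only: cadjoint_plus[OF ops[OF a] ops[OF scM[of c]]])
    then have "\<Phi> (cadjoint ?b) = (\<lambda>x. ?q x + scaleC (cnj c) x)"
      using schwartz_map_plus[OF S aM scM] sc by simp
    moreover have "\<Phi> ?b = (\<lambda>x. ?p x + scaleC c x)"
      using schwartz_map_plus[OF S a scM] sc by simp
    ultimately have "Im (cinner v (?q (?p v + scaleC c v) + scaleC (cnj c) (?p v + scaleC c v))) = 0"
      using real[OF von_neumann_algebra_plus[OF M a scM[of c]], of v] by simp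
    moreover have "cinner v (?q (?p v + scaleC c v) + scaleC (cnj c) (?p v + scaleC c v)) =
      cinner v (?q (?p v)) + (cinner v (scaleC c (?q v)) + cinner v (scaleC (cnj c) (?p v)))
        + (c * cnj c) * cinner v v"
      by (simp add: bounded_clinear_add[OF qc] bounded_clinear_scaleC[OF qc] cinner_simps algebra_simps
          del: times_complex.sel)
    moreover have "Im ((c * cnj c) * cinner v v) = 0"
      unfolding complex_norm_square[symmetric] cinner_self by (simp flip: of_real_mult)
    ultimately show ?thesis using real[OF a, of v]
      by (simp only: plus_complex.sel add_0_left add_0_right)
  qed
  have "cinner v (?q v) = cinner v (cadjoint ?p v)" for v
  proof -
    have "cinner v (cadjoint ?p v) = cnj (cinner v (?p v))"
      by (metis cinner_cadjoint[OF p] cinner_commute)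
    \<comment> \<open>c = 1 makes the imaginary parts opposite, c = \<i> makes the real parts
      equal.\<close>
    moreover have "cinner v (?q v) = cnj (cinner v (?p v))"
      using im[of v 1] im[of v \<i>] by (simp add: complex_eq_iff cinner_scaleC_right)
    ultimately show ?thesis by simp
  qed
  then show ?thesis by (intro bounded_ops_form_ext q cadjoint_props(1) p)
qed

section \<open>Contractivity and positivity of Schwartz maps\<close>

lemma schwartz_inequality:
  assumes M: "von_neumann_algebra M" and S: "unital_schwartz_map M \<Phi>" and a: "a \<in> M"
  shows "(norm (\<Phi> a v))\<^sup>2 \<le> Re (cinner v (\<Phi> (cadjoint a \<circ> a) v))"
proof -
  have p: "\<Phi> a \<in> bounded_ops"
    using von_neumann_algebra_bounded_ops[OF M] schwartz_map_closed[OF S a] by blast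
  have "0 \<le> Re (cinner v (\<Phi> (cadjoint a \<circ> a) v - (\<Phi> (cadjoint a) \<circ> \<Phi> a) v))"
    using S a by (auto simp: unital_schwartz_map_def op_le_def positive_op_iff)
  then show ?thesis
    by (simp add: schwartz_map_cadjoint[OF M S a] cinner_diff_right cinner_cadjoint[OF p]
        power2_norm_eq_Re_cinner)
qed

text \<open>Otherwise some \<open>a n\<close> in the unit ball have \<open>n < cmod (cinner u (\<Phi> (a n) u))\<close>, while
  \<open>a n / n\<close> tends to zero ultraweakly.\<close>

lemma schwartz_map_form_bounded:
  assumes M: "von_neumann_algebra M" and S: "unital_schwartz_map M \<Phi>"
  shows "\<exists>K. \<forall>a\<in>M. (\<forall>x. norm (a x) \<le> norm x) \<longrightarrow> cmod (cinner u (\<Phi> a u)) \<le> K"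
proof (rule ccontr)
  assume "\<not> ?thesis"
  then have "\<forall>n. \<exists>a. a \<in> M \<and> (\<forall>x. norm (a x) \<le> norm x) \<and> real (Suc n) < cmod (cinner u (\<Phi> a u))"
    by (meson not_less)
  then obtain a where a: "\<And>n. a n \<in> M" "\<And>n x. norm (a n x) \<le> norm x"
      "\<And>n. real (Suc n) < cmod (cinner u (\<Phi> (a n) u))"
    by metis
  let ?c = "\<lambda>n. complex_of_real (inverse (real (Suc n)))"
  define y where "y n = (\<lambda>x. scaleC (?c n) (a n x))" for n
  have yM: "y n \<in> M" for n unfolding y_def by (intro von_neumann_algebra_scale[OF M] a)
  have ynorm: "norm (y n x) \<le> inverse (real (Suc n)) * norm x" for n x
    unfolding y_def norm_scaleC norm_of_real by (intro mult_mono a) auto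
  have "inverse (real (Suc n)) \<le> 1" for n by (simp add: inverse_le_1_iff)
  then have y1: "norm (y n x) \<le> 1 * norm x" for n x
    using order_trans[OF ynorm mult_right_mono] norm_ge_zero by blast
  have "limitin (ultraweak_on M) y (\<lambda>x. 0) sequentially"
  proof (rule limitin_ultraweakI[OF _ yM y1 von_neumann_algebra_zero[OF M]])
    show "M \<subseteq> bounded_ops" using M by (simp add: von_neumann_algebra_def)
    fix v w
    have "(\<lambda>n. y n w) \<longlonglongrightarrow> 0"
    proof (rule Lim_null_comparison)
      show "eventually (\<lambda>n. norm (y n w) \<le> inverse (real (Suc n)) * norm w) sequentially"
        by (intro always_eventually allI ynorm)
      show "(\<lambda>n. inverse (real (Suc n)) * norm w) \<longlonglongrightarrow> 0"
        using tendsto_mult_right[OF LIMSEQ_inverse_real_of_nat, of "norm w"] by simp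
    qed
    then show "(\<lambda>n. cinner v (y n w)) \<longlonglongrightarrow> cinner v 0" by (rule tendsto_cinner_right)
  qed
  then have "limitin (ultraweak_on M) (\<Phi> \<circ> y) (\<Phi> (\<lambda>x. 0)) sequentially"
    using S by (intro continuous_map_limit) (auto simp: unital_schwartz_map_def)
  then have "(\<lambda>n. cinner u ((\<Phi> \<circ> y) n u)) \<longlonglongrightarrow> cinner u (\<Phi> (\<lambda>x. 0) u)"
    by (rule limitin_ultraweak_imp_weak)
  moreover have "\<Phi> (\<lambda>x. 0) = (\<lambda>x. 0)"
    using schwartz_map_scale[OF S von_neumann_algebra_zero[OF M], of 0] by simp
  ultimately have "(\<lambda>n. cmod (cinner u (\<Phi> (y n) u))) \<longlonglongrightarrow> 0"
    by (auto dest: tendsto_norm_zero)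
  then have "eventually (\<lambda>n. cmod (cinner u (\<Phi> (y n) u)) < 1) sequentially"
    by (rule order_tendstoD) simp
  then obtain n where n: "cmod (cinner u (\<Phi> (y n) u)) < 1"
    by (auto simp: eventually_sequentially)
  have "\<Phi> (y n) u = scaleC (?c n) (\<Phi> (a n) u)"
    unfolding y_def using schwartz_map_scale[OF S a(1), of "?c n" n] by simp
  then have "cmod (cinner u (\<Phi> (y n) u)) = inverse (real (Suc n)) * cmod (cinner u (\<Phi> (a n) u))"
    by (simp add: cinner_scaleC_right norm_mult norm_inverse del: of_nat_Suc)
  moreover have "1 < inverse (real (Suc n)) * cmod (cinner u (\<Phi> (a n) u))"
    using a(3)[of n] by (simp add: field_simps del: of_nat_Suc)
  ultimately show False using n by simp
qed

text \<open>The supremum \<open>s\<close> of \<open>cmod (cinner u (\<Phi> a u))\<close> over the unit ball satisfies \<open>s\<^sup>2 \<le> s\<close> by the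
  Schwarz inequality.\<close>

lemma schwartz_map_unit_ball:
  assumes M: "von_neumann_algebra M" and S: "unital_schwartz_map M \<Phi>" and a: "a \<in> M"
    and a1: "\<And>x. norm (a x) \<le> norm x" and u: "norm u = 1"
  shows "norm (\<Phi> a u) \<le> 1"
proof -
  define B where "B = {a \<in> M. \<forall>x. norm (a x) \<le> norm x}"
  define f where "f a = cmod (cinner u (\<Phi> a u))" for a
  define s where "s = Sup (f ` B)"
  have bdd: "bdd_above (f ` B)"
    using schwartz_map_form_bounded[OF M S, of u] by (auto simp: bdd_above_def B_def f_def)
  have fs: "f b \<le> s" if "b \<in> B" for b
    unfolding s_def by (rule cSup_upper[OF _ bdd]) (use that in simp)
  \<comment> \<open>The unit ball is stable under forming \<open>cadjoint b \<circ> b\<close>, so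
    the Schwarz inequality bounds \<open>norm (\<Phi> b u)\<close> by the same supremum
    again.\<close>
  have star: "cadjoint b \<circ> b \<in> B" if "b \<in> B" for b
  proof -
    have b: "b \<in> M" "\<And>x. norm (b x) \<le> norm x" using that by (auto simp: B_def)
    have "norm (cadjoint b x) \<le> 1 * norm x" for x
      by (rule norm_cadjoint_le[OF von_neumann_algebra_bounded_ops[OF M b(1)]]) (simp add: b)
    then have "norm (cadjoint b (b x)) \<le> norm x" for x using b(2) order_trans mult_1 by metis
    then show ?thesis using b by (simp add: B_def von_neumann_algebra_closed[OF M])
  qed
  have le_s: "(norm (\<Phi> b u))\<^sup>2 \<le> s" if "b \<in> B" for b
  proof -
    have "(norm (\<Phi> b u))\<^sup>2 \<le> Re (cinner u (\<Phi> (cadjoint b \<circ> b) u))"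
      by (rule schwartz_inequality[OF M S]) (use that in \<open>simp add: B_def\<close>)
    also have "\<dots> \<le> f (cadjoint b \<circ> b)" unfolding f_def by (rule complex_Re_le_cmod)
    also have "\<dots> \<le> s" by (rule fs[OF star[OF that]])
    finally show ?thesis .
  qed
  have id: "id \<in> B" by (simp add: B_def von_neumann_algebra_id[OF M])
  \<comment> \<open>This lower bound, attained at the identity, permits cancelling \<open>s\<close>
    below.\<close>
  have s1: "1 \<le> s"
    using fs[OF id] by (simp add: f_def schwartz_map_id[OF S] cinner_self u)
  have "f b \<le> sqrt s" if "b \<in> B" for b
  proof -
    have "f b \<le> norm (\<Phi> b u)" using norm_cinner_le[of u "\<Phi> b u"] by (simp add: f_def u)
    also have "\<dots> \<le> sqrt s" by (rule real_le_rsqrt) (rule le_s[OF that])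
    finally show ?thesis .
  qed
  then have "s \<le> sqrt s" unfolding s_def using id by (intro cSup_least) auto
  then have "s * s \<le> s * 1" using s1 by (metis abs_of_nonneg dual_order.trans mult.right_neutral
      power2_eq_square power_mono real_sqrt_abs real_sqrt_pow2 zero_le_one)
  then have "s \<le> 1" using s1 by (simp add: mult_le_cancel_left)
  moreover have "(norm (\<Phi> a u))\<^sup>2 \<le> s" by (rule le_s) (simp add: B_def a a1)
  ultimately have "(norm (\<Phi> a u))\<^sup>2 \<le> 1\<^sup>2" by simp
  then show ?thesis by (rule power2_le_imp_le) simp
qed

text \<open>Normalising \<open>a\<close> and \<open>v\<close> reduces this to the unit ball. As the
  constant \<open>C\<close> is preserved, all iterates of one operator share one bound, as the
  cluster point argument requires.\<close>

lemma schwartz_map_contractive: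
  assumes M: "von_neumann_algebra M" and S: "unital_schwartz_map M \<Phi>" and a: "a \<in> M"
    and C: "C > 0" "\<And>x. norm (a x) \<le> C * norm x"
  shows "norm (\<Phi> a v) \<le> C * norm v"
proof (cases "v = 0")
  case True
  have "bounded_clinear (\<Phi> a)"
    using von_neumann_algebra_bounded_clinear[OF M schwartz_map_closed[OF S a]] .
  then show ?thesis using True by (simp add: bounded_clinear_zero)
next
  case False
  let ?b = "\<lambda>x. scaleC (complex_of_real (1 / C)) (a x)"
  let ?u = "scaleC (complex_of_real (1 / norm v)) v"
  have ca: "bounded_clinear (\<Phi> a)"
    using von_neumann_algebra_bounded_clinear[OF M schwartz_map_closed[OF S a]] .
  have "norm (\<Phi> ?b ?u) \<le> 1"
  proof (rule schwartz_map_unit_ball[OF M S von_neumann_algebra_scale[OF M a]])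
    show "norm (?b x) \<le> norm x" for x
      using C(1) C(2)[of x] by (simp add: norm_scaleC field_simps norm_divide)
    show "norm ?u = 1" using False by (simp add: norm_scaleC norm_divide)
  qed
  moreover have "norm (\<Phi> ?b ?u) = norm (\<Phi> a v) / (C * norm v)"
    using C(1) unfolding schwartz_map_scale[OF S a] bounded_clinear_scaleC[OF ca] norm_scaleC
    by (simp add: norm_divide)
  ultimately have "norm (\<Phi> a v) / (C * norm v) \<le> 1" by (simp only:)
  then show ?thesis using C(1) False by (simp add: field_simps)
qed

text \<open>For \<open>0 \<le> h \<le> K\<close> the operator \<open>1 - h / K\<close> is a contraction, hence so is its image.\<close>

lemma schwartz_map_positive:
  assumes M: "von_neumann_algebra M" and S: "unital_schwartz_map M \<Phi>" and h: "h \<in> M" "positive_op h"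
  shows "positive_op (\<Phi> h)"
proof -
  note ops = von_neumann_algebra_bounded_ops[OF M]
  have p: "\<Phi> h \<in> bounded_ops" using ops schwartz_map_closed[OF S h(1)] by blast
  obtain K where K: "K > 0" "\<And>x. norm (h x) \<le> K * norm x"
    using bounded_clinear_bound[OF von_neumann_algebra_bounded_clinear[OF M h(1)]] by blast
  let ?k = "complex_of_real (1 / K)"
  let ?h = "\<lambda>x. scaleC ?k (h x)"
  let ?g = "\<lambda>x. id x - ?h x"
  have hM: "?h \<in> M" by (rule von_neumann_algebra_scale[OF M h(1)])
  have gM: "?g \<in> M" by (intro von_neumann_algebra_minus[OF M] von_neumann_algebra_id[OF M] hM)
  have hle: "Re (cinner x (h x)) \<le> K * (norm x)\<^sup>2" for x
  proof -
    have "Re (cinner x (h x)) \<le> norm x * norm (h x)"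
      using complex_Re_le_cmod norm_cinner_le order_trans by blast
    also have "\<dots> \<le> norm x * (K * norm x)" by (intro mult_left_mono K) simp
    finally show ?thesis by (simp add: power2_eq_square mult.left_commute)
  qed
  have form: "cinner x (?g x) = complex_of_real ((norm x)\<^sup>2) - ?k * cinner x (h x)" for x
    by (simp add: cinner_simps cinner_self)
  have hpos: "0 \<le> Re (cinner x (h x))" "Im (cinner x (h x)) = 0" for x
    using h(2) by (auto simp: positive_op_iff)
  have g: "positive_op ?g"
    unfolding positive_op_iff form using ops[OF gM] hle K(1) by (simp add: hpos field_simps)
  have "norm (?g x) \<le> 1 * norm x" for x
    using positive_op_norm_le[OF g, of x] unfolding form using K(1) hpos by simp
  then have "norm (\<Phi> ?g x) \<le> 1 * norm x" for x
    by (intro schwartz_map_contractive[OF M S gM]) auto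
  moreover have "\<Phi> ?g = (\<lambda>x. x - scaleC ?k (\<Phi> h x))"
    using schwartz_map_minus[OF M S von_neumann_algebra_id[OF M] hM] schwartz_map_scale[OF S h(1)]
      schwartz_map_id[OF S] by simp
  ultimately have gn: "norm (x - scaleC ?k (\<Phi> h x)) \<le> norm x" for x by simp
  \<comment> \<open>Contractivity bounds the form of 1 - \<Phi>(h)/K at \<open>x\<close> by the
    squared norm of \<open>x\<close>; subtracting that squared norm leaves the sign of the form of
    \<Phi>(h).\<close>
  have "0 \<le> Re (cinner x (\<Phi> h x))" for x
  proof -
    have "Re (cinner x (x - scaleC ?k (\<Phi> h x))) \<le> norm x * norm (x - scaleC ?k (\<Phi> h x))"
      using complex_Re_le_cmod norm_cinner_le order_trans by blast
    also have "\<dots> \<le> norm x * norm x" by (intro mult_left_mono gn) simp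
    finally have "(1 / K) * Re (cinner x (\<Phi> h x)) \<ge> 0"
      by (simp add: cinner_simps cinner_self power2_eq_square)
    then show ?thesis using K(1) by (simp add: zero_le_divide_iff)
  qed
  moreover have "Im (cinner x (\<Phi> h x)) = 0" for x
  proof -
    have "cadjoint (\<Phi> h) = \<Phi> h"
      using schwartz_map_cadjoint[OF M S h(1)] positive_op_cadjoint[OF h(2)] by simp
    then have "cinner x (\<Phi> h x) = cnj (cinner x (\<Phi> h x))"
      by (metis cinner_cadjoint[OF p] cinner_commute)
    then show ?thesis by (simp add: complex_eq_iff)
  qed
  ultimately show ?thesis using p by (simp add: positive_op_iff)
qed

section \<open>Composition, powers and multiplicativity\<close>

lemma unital_schwartz_map_id:
  assumes M: "von_neumann_algebra M"
  shows "unital_schwartz_map M id"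
proof -
  have "op_le (\<lambda>x. 0) (cadjoint a \<circ> a)" "op_le (cadjoint a \<circ> a) (cadjoint a \<circ> a)" if "a \<in> M" for a
    using cadjoint_comp_positive[OF von_neumann_algebra_bounded_ops[OF M that]]
      von_neumann_algebra_bounded_ops[OF M von_neumann_algebra_zero[OF M]]
    by (simp_all add: op_le_def positive_op_iff comp_def)
  then show ?thesis
    by (simp add: unital_schwartz_map_def linear_map_on_def continuous_map_id[unfolded id_def] id_def)
qed

text \<open>The Schwarz inequality of \<Phi> at \<Psi>(a) is chained with the image under \<Phi> of
  the inequality for \<Psi>; the latter is preserved because \<Phi> is positive.\<close>

lemma unital_schwartz_map_comp:
  assumes M: "von_neumann_algebra M" and S: "unital_schwartz_map M \<Phi>" and T: "unital_schwartz_map M \<Psi>"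
  shows "unital_schwartz_map M (\<Phi> \<circ> \<Psi>)"
  unfolding unital_schwartz_map_def
proof (intro conjI ballI)
  show "continuous_map (ultraweak_on M) (ultraweak_on M) (\<Phi> \<circ> \<Psi>)"
    using S T by (intro continuous_map_compose) (auto simp: unital_schwartz_map_def)
  show "linear_map_on M (\<Phi> \<circ> \<Psi>)"
    using S T by (simp add: unital_schwartz_map_def linear_map_on_def)
  show "(\<Phi> \<circ> \<Psi>) id = id" using S T by (simp add: unital_schwartz_map_def)
  fix a assume a: "a \<in> M"
  note cl = von_neumann_algebra_closed[OF M] schwartz_map_closed[OF S] schwartz_map_closed[OF T] a
  have adj: "\<Psi> (cadjoint a) = cadjoint (\<Psi> a)" by (rule schwartz_map_cadjoint[OF M T a])
  show "(\<Phi> \<circ> \<Psi>) a \<in> M" by (simp add: cl)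
  have S': "op_le (\<lambda>x. 0) (\<Phi> (cadjoint (\<Psi> a)) \<circ> \<Phi> (\<Psi> a))"
    "op_le (\<Phi> (cadjoint (\<Psi> a)) \<circ> \<Phi> (\<Psi> a)) (\<Phi> (cadjoint (\<Psi> a) \<circ> \<Psi> a))"
    using S cl(9) by (auto simp: unital_schwartz_map_def cl)
  show "op_le (\<lambda>x. 0) ((\<Phi> \<circ> \<Psi>) (cadjoint a) \<circ> (\<Phi> \<circ> \<Psi>) a)" using S'(1) by (simp add: adj)
  have "op_le (cadjoint (\<Psi> a) \<circ> \<Psi> a) (\<Psi> (cadjoint a \<circ> a))"
    using T a unfolding adj[symmetric] by (auto simp: unital_schwartz_map_def)
  moreover have "(\<lambda>x. \<Psi> (cadjoint a \<circ> a) x - (cadjoint (\<Psi> a) \<circ> \<Psi> a) x) \<in> M"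
    by (rule von_neumann_algebra_minus[OF M, of "\<Psi> (cadjoint a \<circ> a)" "cadjoint (\<Psi> a) \<circ> \<Psi> a"])
      (simp_all add: cl)
  ultimately have "positive_op (\<Phi> (\<lambda>x. \<Psi> (cadjoint a \<circ> a) x - (cadjoint (\<Psi> a) \<circ> \<Psi> a) x))"
    unfolding op_le_def by (intro schwartz_map_positive[OF M S])
  then have "op_le (\<Phi> (cadjoint (\<Psi> a) \<circ> \<Psi> a)) (\<Phi> (\<Psi> (cadjoint a \<circ> a)))"
    unfolding op_le_def by (subst (asm) schwartz_map_minus[OF M S]) (simp_all add: cl)
  then show "op_le ((\<Phi> \<circ> \<Psi>) (cadjoint a) \<circ> (\<Phi> \<circ> \<Psi>) a) ((\<Phi> \<circ> \<Psi>) (cadjoint a \<circ> a))"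
    using op_le_trans[OF S'(2)] by (simp add: adj)
qed

lemma unital_schwartz_map_funpow:
  "von_neumann_algebra M \<Longrightarrow> unital_schwartz_map M \<Phi> \<Longrightarrow> unital_schwartz_map M (\<Phi> ^^ n)"
  by (induction n) (simp_all add: unital_schwartz_map_id[unfolded id_def] unital_schwartz_map_id unital_schwartz_map_comp)

text \<open>The defect \<open>cinner v (\<Phi> (cadjoint x \<circ> y) v) - cinner (\<Phi> x v) (\<Phi> y v)\<close> is a positive
  semidefinite form in \<open>x\<close>, \<open>y\<close>, and \<open>d\<close> is a null vector of it.\<close>

lemma schwartz_map_mult_right:
  assumes M: "von_neumann_algebra M" and S: "unital_schwartz_map M \<Phi>" and a: "a \<in> M" and d: "d \<in> M"
    and eq: "\<Phi> (cadjoint d \<circ> d) = \<Phi> (cadjoint d) \<circ> \<Phi> d"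
  shows "\<Phi> (a \<circ> d) = \<Phi> a \<circ> \<Phi> d"
proof -
  note cl = von_neumann_algebra_closed[OF M] schwartz_map_closed[OF S]
  note ops = von_neumann_algebra_bounded_ops[OF M]
  \<comment> \<open>Writing \<open>a\<close> as an adjoint turns \<open>a \<circ> d\<close> into the
    mixed entry (b, d) of the defect form.\<close>
  define b where "b = cadjoint a"
  have b: "b \<in> M" "cadjoint b = a"
    using a by (auto simp: b_def cl cadjoint_cadjoint ops)
  let ?m = "\<lambda>x y. \<Phi> (cadjoint x \<circ> y)"
  have "cadjoint d \<circ> b = cadjoint (cadjoint b \<circ> d)"
    using b(1) d by (simp add: cadjoint_comp ops cl cadjoint_cadjoint)
  then have adj: "?m d b = cadjoint (?m b d)"
    using b(1) d by (simp only: schwartz_map_cadjoint[OF M S] cl)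
  have "cinner v (\<Phi> (a \<circ> d) v) = cinner v ((\<Phi> a \<circ> \<Phi> d) v)" for v
  proof -
    let ?\<gamma> = "cinner v (?m b d v) - cinner (\<Phi> b v) (\<Phi> d v)"
    let ?\<alpha> = "Re (cinner v (?m b b v)) - (norm (\<Phi> b v))\<^sup>2"
    \<comment> \<open>This is the Schwarz inequality at b + c d. The coefficient 0 is the defect of
      \<open>d\<close>, which vanishes by \<open>eq\<close>, so the mixed defect
      \<open>?\<gamma>\<close> must vanish too.\<close>
    have "0 \<le> ?\<alpha> + 2 * Re (c * ?\<gamma>) + (cmod c)\<^sup>2 * 0" for c
    proof -
      let ?x = "\<lambda>x. b x + scaleC c (d x)"
      have "cadjoint ?x = (\<lambda>x. cadjoint b x + scaleC (cnj c) (cadjoint d x))"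
        using b(1) d by (simp add: cadjoint_plus cadjoint_scale ops cl)
      moreover have "bounded_clinear (cadjoint b)" "bounded_clinear (cadjoint d)"
        using b(1) d ops cl(7) by (auto simp: bounded_ops_def)
      ultimately have e: "cadjoint ?x \<circ> ?x = (\<lambda>x. (cadjoint b \<circ> b) x + (scaleC c ((cadjoint b \<circ> d) x)
          + (scaleC (cnj c) ((cadjoint d \<circ> b) x) + scaleC (c * cnj c) ((cadjoint d \<circ> d) x))))"
        by (auto simp: fun_eq_iff bounded_clinear_add bounded_clinear_scaleC scaleC_add_right
            scaleC_scaleC mult.commute algebra_simps)
      have "\<Phi> (cadjoint ?x \<circ> ?x) = (\<lambda>x. ?m b b x + (scaleC c (?m b d x)
          + (scaleC (cnj c) (?m d b x) + scaleC (c * cnj c) (?m d d x))))"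
        unfolding e using b(1) d
        by (simp only: schwartz_map_plus[OF S] schwartz_map_scale[OF S] cl)
      moreover have "\<Phi> ?x = (\<lambda>x. \<Phi> b x + scaleC c (\<Phi> d x))"
        using b(1) d by (simp only: schwartz_map_plus[OF S] schwartz_map_scale[OF S] cl)
      ultimately have "(norm (\<Phi> b v + scaleC c (\<Phi> d v)))\<^sup>2 \<le> Re (cinner v (?m b b v + (scaleC c (?m b d v)
          + (scaleC (cnj c) (?m d b v) + scaleC (c * cnj c) (?m d d v)))))"
        using schwartz_inequality[OF M S, of ?x v] b(1) d by (simp add: cl)
      also have "\<dots> = Re (cinner v (?m b b v)) + Re (c * cinner v (?m b d v))
          + Re (cnj c * cinner v (?m d b v)) + Re (c * cnj c * cinner v (?m d d v))"
        by (simp add: cinner_simps del: times_complex.sel)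
      also have "Re (cnj c * cinner v (?m d b v)) = Re (c * cinner v (?m b d v))"
      proof -
        have "cinner v (?m d b v) = cnj (cinner v (?m b d v))"
          unfolding adj by (metis b(1) d cl cinner_cadjoint ops cinner_commute)
        then show ?thesis by simp
      qed
      also have "cinner v (?m d d v) = complex_of_real ((norm (\<Phi> d v))\<^sup>2)"
        using d by (simp add: eq schwartz_map_cadjoint[OF M S] cinner_cadjoint ops cl cinner_self)
      also have "Re (c * cnj c * complex_of_real ((norm (\<Phi> d v))\<^sup>2)) = (cmod c)\<^sup>2 * (norm (\<Phi> d v))\<^sup>2"
        unfolding complex_norm_square[symmetric] by simp
      finally show ?thesis
        by (simp add: power2_norm_add norm_scaleC power_mult_distrib cinner_scaleC_right
            right_diff_distrib comp_def del: times_complex.sel)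
    qed
    from cauchy_schwarz_from_nonneg[OF this] have "?\<gamma> = 0" by simp
    moreover have "\<Phi> a = cadjoint (\<Phi> b)" using schwartz_map_cadjoint[OF M S b(1)] b(2) by simp
    ultimately show ?thesis using b by (simp add: cinner_cadjoint ops cl)
  qed
  then show ?thesis
    by (intro bounded_ops_form_ext bounded_ops_comp ops) (simp_all add: cl a d)
qed

section \<open>The GNS contraction\<close>

lemma gns_cinner:
  assumes M: "von_neumann_algebra M" and G: "gns_representation M \<phi> \<pi> \<Omega>" and a: "a \<in> M" and b: "b \<in> M"
  shows "cinner (\<pi> a \<Omega>) (\<pi> b \<Omega>) = \<phi> (cadjoint a \<circ> b)"
proof -
  have aM: "cadjoint a \<in> M" by (rule von_neumann_algebra_cadjoint[OF M a])
  have "\<phi> (cadjoint a \<circ> b) = cinner \<Omega> (\<pi> (cadjoint a \<circ> b) \<Omega>)"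
    using G von_neumann_algebra_comp[OF M aM b] by (simp add: gns_representation_def)
  also have "\<pi> (cadjoint a \<circ> b) = cadjoint (\<pi> a) \<circ> \<pi> b"
    using G a b aM by (simp add: gns_representation_def)
  also have "cinner \<Omega> ((cadjoint (\<pi> a) \<circ> \<pi> b) \<Omega>) = cinner (\<pi> a \<Omega>) (\<pi> b \<Omega>)"
    using G a by (simp add: gns_representation_def cinner_cadjoint)
  finally show ?thesis by (rule sym)
qed

lemma gns_dense: "gns_representation M \<phi> \<pi> \<Omega> \<Longrightarrow> closure ((\<lambda>a. \<pi> a \<Omega>) ` M) = UNIV"
  by (simp add: gns_representation_def)

text \<open>Against the dense vectors \<pi>(a)\<Omega> this is the defining relation of the state
  adjoint. It makes negative indices instances of the same statements as positive ones.\<close>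

lemma gns_contraction_cadjoint:
  assumes M: "von_neumann_algebra M" and G: "gns_representation M \<phi> \<pi> \<Omega>"
    and adj: "is_state_adjoint M \<phi> \<Phi> \<Phi>'" and S: "unital_schwartz_map M \<Phi>"
    and U: "is_gns_contraction M \<Phi> \<pi> \<Omega> U"
  shows "is_gns_contraction M \<Phi>' \<pi> \<Omega> (cadjoint U)"
proof -
  have Ub: "U \<in> bounded_ops" using U by (simp add: is_gns_contraction_def bounded_ops_def)
  have S': "unital_schwartz_map M \<Phi>'" using adj by (simp add: is_state_adjoint_def)
  have "cadjoint U (\<pi> b \<Omega>) = \<pi> (\<Phi>' b) \<Omega>" if b: "b \<in> M" for b
  proof (rule cinner_eqI_dense[OF gns_dense[OF G]])
    fix z assume "z \<in> (\<lambda>a. \<pi> a \<Omega>) ` M"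
    then obtain a where a: "a \<in> M" "z = \<pi> a \<Omega>" by blast
    note cl = von_neumann_algebra_cadjoint[OF M] schwartz_map_closed[OF S] schwartz_map_closed[OF S']
    have "cinner (cadjoint U (\<pi> b \<Omega>)) z = cinner (\<pi> b \<Omega>) (\<pi> (\<Phi> a) \<Omega>)"
      using U a by (simp add: cinner_cadjoint'[OF Ub] is_gns_contraction_def)
    also have "\<dots> = \<phi> (cadjoint b \<circ> \<Phi> a)" by (rule gns_cinner[OF M G b]) (simp add: cl a)
    also have "\<dots> = \<phi> (\<Phi>' (cadjoint b) \<circ> a)" using adj a b by (simp add: is_state_adjoint_def cl)
    also have "\<dots> = cinner (\<pi> (\<Phi>' b) \<Omega>) z"
      using gns_cinner[OF M G _ a(1)] schwartz_map_cadjoint[OF M S' b] by (simp add: cl a b)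
    finally show "cinner z (cadjoint U (\<pi> b \<Omega>)) = cinner z (\<pi> (\<Phi>' b) \<Omega>)"
      by (metis cinner_commute)
  qed
  moreover have "norm (cadjoint U x) \<le> 1 * norm x" for x
    by (rule norm_cadjoint_le[OF Ub]) (use U in \<open>simp add: is_gns_contraction_def\<close>)
  ultimately show ?thesis
    using cadjoint_props(1)[OF Ub] by (simp add: is_gns_contraction_def bounded_ops_def)
qed

lemma gns_contraction_comp:
  assumes "is_gns_contraction M \<Phi> \<pi> \<Omega> U" "is_gns_contraction M \<Psi> \<pi> \<Omega> V" "\<And>a. a \<in> M \<Longrightarrow> \<Psi> a \<in> M"
  shows "is_gns_contraction M (\<Phi> \<circ> \<Psi>) \<pi> \<Omega> (U \<circ> V)"
  using assms by (auto simp: is_gns_contraction_def bounded_clinear_comp intro: order_trans)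

lemma gns_contraction_funpow:
  assumes "is_gns_contraction M \<Phi> \<pi> \<Omega> U" and "\<And>a. a \<in> M \<Longrightarrow> \<Phi> a \<in> M"
  shows "is_gns_contraction M (\<Phi> ^^ n) \<pi> \<Omega> (U ^^ n)"
proof (induction n)
  case 0
  show ?case by (simp add: is_gns_contraction_def bounded_clinear_id[unfolded id_def] id_def)
next
  case (Suc n)
  have "(\<Phi> ^^ n) a \<in> M" if "a \<in> M" for a using that assms(2) by (induction n) auto
  then show ?case using gns_contraction_comp[OF assms(1) Suc] by (simp only: funpow.simps)
qed

section \<open>Powers of a positive contraction\<close>

lemma cinner_funpow_adjoint:
  fixes f g :: "'a::complex_inner \<Rightarrow> 'a"
  assumes "\<And>x y. cinner (f x) y = cinner x (g y)"
  shows "cinner ((f ^^ n) x) y = cinner x ((g ^^ n) y)"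
proof (induction n arbitrary: x y)
  case (Suc n)
  have "cinner ((f ^^ Suc n) x) y = cinner x ((g ^^ n) (g y))" by (simp add: assms Suc)
  then show ?case by (simp only: funpow_Suc_right comp_apply)
qed simp

text \<open>The sequence \<open>s n = Re (cinner x ((V' \<circ> V) ^^ n) x)\<close> decreases, and
  \<open>s (2 * m) - 2 * s (m + n) + s (2 * n)\<close> is the squared distance of the iterates.\<close>

lemma positive_contraction_powers_converge:
  fixes V V' :: "'g::chilbert_space \<Rightarrow> 'g"
  assumes adj: "\<And>x y. cinner (V x) y = cinner x (V' y)"
    and V: "\<And>x. norm (V x) \<le> norm x" and V': "\<And>x. norm (V' x) \<le> norm x"
  shows "\<exists>z. (\<lambda>n. ((V' \<circ> V) ^^ n) x) \<longlonglongrightarrow> z"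
proof -
  let ?S = "V' \<circ> V"
  let ?x = "\<lambda>n. (?S ^^ n) x"
  have adj': "cinner (V' u) v = cinner u (V v)" for u v
    by (metis adj cinner_commute)
  have S: "cinner (?S u) v = cinner u (?S v)" for u v by (simp add: adj adj')
  define s where "s n = Re (cinner x (?x n))" for n
  have sadd: "Re (cinner (?x m) (?x n)) = s (m + n)" for m n
    using cinner_funpow_adjoint[where f = ?S and g = ?S, OF S] by (simp add: s_def funpow_add)
  \<comment> \<open>Even terms are squared norms of iterates and odd terms squared norms of their
    images under \<open>V\<close>; passing from one index to the next applies \<open>V\<close> or
    \<open>V'\<close> in turn, so \<open>s\<close> decreases.\<close>
  have even: "s (m + m) = (norm (?x m))\<^sup>2" for m by (simp add: sadd[symmetric] power2_norm_eq_Re_cinner)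
  have odd: "s (Suc (m + m)) = (norm (V (?x m)))\<^sup>2" for m
    using sadd[of m "Suc m"] by (simp add: power2_norm_eq_Re_cinner adj)
  have "s (Suc n) \<le> s n" for n
  proof (cases "even n")
    case True
    then obtain m where "n = m + m" by (metis evenE mult_2)
    then show ?thesis using V[of "?x m"] by (simp add: odd even power_mono)
  next
    case False
    then obtain m where n: "n = Suc (m + m)" by (metis oddE mult_2 add.commute plus_1_eq_Suc)
    have "s (Suc n) = (norm (V' (V (?x m))))\<^sup>2" using even[of "Suc m"] n by simp
    then show ?thesis using V'[of "V (?x m)"] n by (simp add: odd power_mono)
  qed
  then have dec: "decseq s" by (simp add: decseq_Suc_iff)
  have nonneg: "0 \<le> s n" for n
  proof (cases "even n")
    case True
    then show ?thesis using even by (metis evenE mult_2 zero_le_power2)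
  next
    case False
    then show ?thesis using odd by (metis oddE mult_2 add.commute plus_1_eq_Suc zero_le_power2)
  qed
  obtain L where L: "s \<longlonglongrightarrow> L" "\<And>i. L \<le> s i"
    using decseq_convergent[OF dec, of 0] nonneg by blast
  have "Cauchy ?x"
  proof (rule metric_CauchyI)
    fix e :: real assume e: "e > 0"
    have "eventually (\<lambda>n. s n < L + e\<^sup>2 / 2) sequentially"
      by (rule order_tendstoD(2)[OF L(1)]) (use e in simp)
    then obtain N where N: "\<And>n. n \<ge> N \<Longrightarrow> s n < L + e\<^sup>2 / 2" by (auto simp: eventually_sequentially)
    show "\<exists>N. \<forall>m\<ge>N. \<forall>n\<ge>N. dist (?x m) (?x n) < e"
    proof (intro exI allI impI)
      fix m n assume mn: "m \<ge> N" "n \<ge> N"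
      have "(norm (?x m - ?x n))\<^sup>2 = s (m + m) - 2 * s (m + n) + s (n + n)"
        unfolding power2_norm_diff even sadd ..
      also have "\<dots> < e\<^sup>2" using N[of "m + m"] N[of "n + n"] L(2)[of "m + n"] mn by simp
      finally show "dist (?x m) (?x n) < e"
        using e by (simp add: dist_norm power_less_imp_less_base)
    qed
  qed
  then show ?thesis by (auto simp: Cauchy_convergent_iff convergent_def)
qed

section \<open>Isometric vectors and the multiplicative domain\<close>

text \<open>This links a weak limit inside \<open>M\<close> to a norm limit in the GNS space.
  Pairing with \<pi>(b)\<Omega> gives \<phi> at \<open>cadjoint b \<circ> x n\<close>, a bounded
  weakly convergent family, and \<phi> is normal.\<close>

lemma gns_weak_limit:
  assumes M: "von_neumann_algebra M" and st: "normal_faithful_state M \<phi>"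
    and G: "gns_representation M \<phi> \<pi> \<Omega>"
    and x: "\<And>n. x n \<in> M" and l: "l \<in> M" and bd: "\<And>n v. norm (x n v) \<le> C * norm v"
    and lim: "\<And>u v. ((\<lambda>n. cinner u (x n v)) \<longlongrightarrow> cinner u (l v)) F"
    and F: "F \<noteq> bot" and z: "((\<lambda>n. \<pi> (x n) \<Omega>) \<longlongrightarrow> z) F"
  shows "\<pi> l \<Omega> = z"
proof (rule cinner_eqI_dense[OF gns_dense[OF G]])
  fix w assume "w \<in> (\<lambda>a. \<pi> a \<Omega>) ` M"
  then obtain b where b: "b \<in> M" "w = \<pi> b \<Omega>" by blast
  have bc: "cadjoint b \<in> M" by (rule von_neumann_algebra_cadjoint[OF M b(1)])
  obtain K where K: "K > 0" "\<And>v. norm (cadjoint b v) \<le> K * norm v"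
    using bounded_clinear_bound[OF von_neumann_algebra_bounded_clinear[OF M bc]] by blast
  have "limitin (ultraweak_on M) (\<lambda>n. cadjoint b \<circ> x n) (cadjoint b \<circ> l) F"
  proof (rule limitin_ultraweakI)
    show "M \<subseteq> bounded_ops" using M by (simp add: von_neumann_algebra_def)
    show "norm ((cadjoint b \<circ> x n) v) \<le> (K * C) * norm v" for n v
      using order_trans[OF K(2)[of "x n v"] mult_left_mono[OF bd[of n v], of K]] K(1)
      by (simp add: mult.assoc)
    show "((\<lambda>n. cinner u ((cadjoint b \<circ> x n) v)) \<longlongrightarrow> cinner u ((cadjoint b \<circ> l) v)) F" for u v
      using lim[of "b u" v] by (simp add: cinner_cadjoint von_neumann_algebra_bounded_ops[OF M b(1)])
  qed (simp_all add: von_neumann_algebra_comp[OF M] bc x l)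
  then have "limitin euclidean (\<phi> \<circ> (\<lambda>n. cadjoint b \<circ> x n)) (\<phi> (cadjoint b \<circ> l)) F"
    using st by (intro continuous_map_limit) (auto simp: normal_faithful_state_def)
  then have "((\<lambda>n. cinner w (\<pi> (x n) \<Omega>)) \<longlongrightarrow> cinner w (\<pi> l \<Omega>)) F"
    by (simp add: b comp_def gns_cinner[OF M G b(1)] x l)
  moreover have "((\<lambda>n. cinner w (\<pi> (x n) \<Omega>)) \<longlongrightarrow> cinner w z) F"
    by (rule tendsto_cinner_right[OF z])
  ultimately show "cinner w (\<pi> l \<Omega>) = cinner w z" by (rule tendsto_unique[OF F])
qed

text \<open>Isometry at \<pi>(a)\<Omega> says that \<phi> vanishes on the Schwarz defect of
  \<open>a\<close>, a positive element, and \<phi> is faithful.\<close>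

lemma schwartz_equality_of_isometric:
  assumes M: "von_neumann_algebra M" and st: "normal_faithful_state M \<phi>"
    and G: "gns_representation M \<phi> \<pi> \<Omega>"
    and S: "unital_schwartz_map M \<Phi>" and inv: "\<And>a. a \<in> M \<Longrightarrow> \<phi> (\<Phi> a) = \<phi> a"
    and V: "is_gns_contraction M \<Phi> \<pi> \<Omega> V" and a: "a \<in> M"
    and iso: "norm (V (\<pi> a \<Omega>)) = norm (\<pi> a \<Omega>)"
  shows "\<Phi> (cadjoint a \<circ> a) = \<Phi> (cadjoint a) \<circ> \<Phi> a"
proof -
  note cl = von_neumann_algebra_closed[OF M] schwartz_map_closed[OF S]
  let ?b = "\<Phi> (cadjoint a \<circ> a)" and ?c = "\<Phi> (cadjoint a) \<circ> \<Phi> a"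
  have bc: "?b \<in> M" "?c \<in> M" by (simp_all add: cl a)
  have "V (\<pi> a \<Omega>) = \<pi> (\<Phi> a) \<Omega>" using V a by (simp add: is_gns_contraction_def)
  then have "\<phi> ?c = cinner (V (\<pi> a \<Omega>)) (V (\<pi> a \<Omega>))"
    using gns_cinner[OF M G, of "\<Phi> a" "\<Phi> a"] by (simp add: cl a schwartz_map_cadjoint[OF M S])
  also have "\<dots> = cinner (\<pi> a \<Omega>) (\<pi> a \<Omega>)" by (simp only: cinner_self iso)
  also have "\<dots> = \<phi> ?b" using gns_cinner[OF M G a a] inv[of "cadjoint a \<circ> a"] by (simp add: cl a)
  finally have eq: "\<phi> ?c = \<phi> ?b" .
  have lin: "linear_functional_on M \<phi>" using st by (simp add: normal_faithful_state_def)
  have "\<phi> (\<lambda>x. ?b x + scaleC (-1) (?c x)) = \<phi> ?b + (-1) * \<phi> ?c"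
    using lin bc von_neumann_algebra_scale[OF M bc(2), of "-1"] unfolding linear_functional_on_def by metis
  then have "\<phi> (\<lambda>x. ?b x - ?c x) = 0" using eq by (simp add: scaleC_minus_one)
  moreover have "positive_op (\<lambda>x. ?b x - ?c x)"
    using S a by (auto simp: unital_schwartz_map_def op_le_def)
  moreover have "(\<lambda>x. ?b x - ?c x) \<in> M" by (rule von_neumann_algebra_minus[OF M bc])
  ultimately have "(\<lambda>x. ?b x - ?c x) = (\<lambda>x. 0)"
    using st unfolding normal_faithful_state_def by blast
  then show ?thesis by (metis eq_iff_diff_eq_0 ext)
qed

text \<open>Stated for a mutually adjoint pair of implementing contractions, so that it covers the
  powers of \<open>U\<close> and, with the roles exchanged, those of its adjoint.\<close>

lemma isometric_vectors_eq_closure: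
  fixes \<pi> :: "('h::chilbert_space \<Rightarrow> 'h) \<Rightarrow> 'g::chilbert_space \<Rightarrow> 'g"
  assumes M: "von_neumann_algebra M" and st: "normal_faithful_state M \<phi>"
    and G: "gns_representation M \<phi> \<pi> \<Omega>"
    and S: "unital_schwartz_map M \<Phi>" and S': "unital_schwartz_map M \<Phi>'"
    and inv: "\<And>a. a \<in> M \<Longrightarrow> \<phi> (\<Phi> a) = \<phi> a"
    and V: "is_gns_contraction M \<Phi> \<pi> \<Omega> V" and V': "is_gns_contraction M \<Phi>' \<pi> \<Omega> V'"
    and adj: "\<And>x y. cinner (V x) y = cinner x (V' y)"
  shows "closure ((\<lambda>a. \<pi> a \<Omega>) ` multiplicative_domain M \<Phi>) = {x. norm (V x) = norm x}"
    (is "closure ?D = _")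
proof
  note cl = von_neumann_algebra_closed[OF M]
  have Vc: "bounded_clinear V" and V'c: "bounded_clinear V'" using V V' by (auto simp: is_gns_contraction_def)
  have Vn: "norm (V x) \<le> norm x" and V'n: "norm (V' x) \<le> norm x" for x
    using V V' by (auto simp: is_gns_contraction_def)
  have cont: "continuous_on UNIV V"
    using linear_continuous_on[OF bounded_clinear_bounded_linear[OF Vc]] .
  show "closure ?D \<subseteq> {x. norm (V x) = norm x}"
  proof (rule closure_minimal)
    show "closed {x. norm (V x) = norm x}"
      by (intro closed_Collect_eq continuous_on_norm cont continuous_on_id)
    show "?D \<subseteq> {x. norm (V x) = norm x}"
    proof clarsimp
      fix a assume "a \<in> multiplicative_domain M \<Phi>"
      then have a: "a \<in> M" "\<Phi> (cadjoint a \<circ> a) = \<Phi> (cadjoint a) \<circ> \<Phi> a"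
        by (auto simp: multiplicative_domain_def)
      have Pa: "\<Phi> a \<in> M" by (rule schwartz_map_closed[OF S a(1)])
      have "V (\<pi> a \<Omega>) = \<pi> (\<Phi> a) \<Omega>" using V a by (simp add: is_gns_contraction_def)
      then have "cinner (V (\<pi> a \<Omega>)) (V (\<pi> a \<Omega>)) = \<phi> (\<Phi> (cadjoint a \<circ> a))"
        using gns_cinner[OF M G Pa Pa] by (simp add: a schwartz_map_cadjoint[OF M S])
      also have "\<dots> = cinner (\<pi> a \<Omega>) (\<pi> a \<Omega>)"
        using gns_cinner[OF M G a(1) a(1)] inv[of "cadjoint a \<circ> a"] by (simp add: cl a(1))
      finally have "(norm (V (\<pi> a \<Omega>)))\<^sup>2 = (norm (\<pi> a \<Omega>))\<^sup>2" by (simp add: power2_norm_eq_Re_cinner)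
      then show "norm (V (\<pi> a \<Omega>)) = norm (\<pi> a \<Omega>)" by simp
    qed
  qed
  show "{x. norm (V x) = norm x} \<subseteq> closure ?D"
  proof clarify
    fix \<psi> assume iso: "norm (V \<psi>) = norm \<psi>"
    let ?S = "V' \<circ> V" and ?T = "\<Phi>' \<circ> \<Phi>"
    have Sc: "bounded_clinear ?S" by (rule bounded_clinear_comp[OF V'c Vc])
    have T: "unital_schwartz_map M ?T" by (rule unital_schwartz_map_comp[OF M S' S])
    note Tn = unital_schwartz_map_funpow[OF M T]
    have gT: "is_gns_contraction M ?T \<pi> \<Omega> ?S"
      by (rule gns_contraction_comp[OF V' V schwartz_map_closed[OF S]])
    have gTn: "is_gns_contraction M (?T ^^ n) \<pi> \<Omega> (?S ^^ n)" for n
      by (rule gns_contraction_funpow[OF gT schwartz_map_closed[OF T]])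
    \<comment> \<open>Expanding the square gives at most \<open>norm \<psi>\<close> squared, minus
      twice \<open>norm (V \<psi>)\<close> squared, plus \<open>norm \<psi>\<close> squared, which
      is zero for an isometric vector.\<close>
    have "(norm (?S \<psi> - \<psi>))\<^sup>2 \<le> 0"
    proof -
      have "Re (cinner (?S \<psi>) \<psi>) = (norm (V \<psi>))\<^sup>2"
        by (metis adj cinner_commute comp_apply power2_norm_eq_Re_cinner)
      moreover have "norm (?S \<psi>) \<le> norm \<psi>" using V'n[of "V \<psi>"] iso by simp
      then have "(norm (?S \<psi>))\<^sup>2 \<le> (norm \<psi>)\<^sup>2" by (intro power_mono) auto
      ultimately show ?thesis using iso by (simp add: power2_norm_diff)
    qed
    then have S\<psi>: "?S \<psi> = \<psi>" by simp
    have Sn\<psi>: "(?S ^^ n) \<psi> = \<psi>" for n using S\<psi> by (induction n) auto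
    \<comment> \<open>The limit is fixed by continuity, and a fixed vector of
      \<open>V' \<circ> V\<close> is isometric for \<open>V\<close> because the squared norm of
      \<open>V z\<close> is the pairing of \<open>z\<close> with \<open>V' (V z)\<close>.\<close>
    have fixed_limit: "V' (V z) = z \<and> norm (V z) = norm z"
      if z: "(\<lambda>n. (?S ^^ n) x) \<longlonglongrightarrow> z" for x z
    proof -
      have "(\<lambda>n. ?S ((?S ^^ n) x)) \<longlonglongrightarrow> ?S z"
        by (rule bounded_linear.tendsto[OF bounded_clinear_bounded_linear[OF Sc] z])
      moreover have "(\<lambda>n. ?S ((?S ^^ n) x)) \<longlonglongrightarrow> z" using LIMSEQ_Suc[OF z] by simp
      ultimately have Sz: "?S z = z" by (rule LIMSEQ_unique)
      have "(norm (V z))\<^sup>2 = (norm z)\<^sup>2"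
        using Sz by (simp add: power2_norm_eq_Re_cinner adj)
      then show ?thesis using Sz by simp
    qed
    show "\<psi> \<in> closure ?D"
      unfolding closure_approachable
    proof (intro allI impI)
      fix e :: real assume "e > 0"
      moreover have "\<psi> \<in> closure ((\<lambda>a. \<pi> a \<Omega>) ` M)" by (simp add: gns_dense[OF G])
      ultimately obtain a where a: "a \<in> M" "dist (\<pi> a \<Omega>) \<psi> < e"
        unfolding closure_approachable by blast
      define x where "x n = (?T ^^ n) a" for n
      obtain C where C: "C > 0" "\<And>v. norm (a v) \<le> C * norm v"
        using bounded_clinear_bound[OF von_neumann_algebra_bounded_clinear[OF M a(1)]] by blast
      have xM: "x n \<in> M" for n unfolding x_def by (rule schwartz_map_closed[OF Tn a(1)])
      have xbd: "norm (x n v) \<le> C * norm v" for n v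
        unfolding x_def by (rule schwartz_map_contractive[OF M Tn a(1) C])
      have xb: "x n \<in> bounded_ops" for n by (rule von_neumann_algebra_bounded_ops[OF M xM])
      obtain F l where F: "F \<noteq> bot" "F \<le> sequentially" and l: "l \<in> M"
        and lim: "\<And>u v. ((\<lambda>n. cinner u (x n v)) \<longlongrightarrow> cinner u (l v)) F"
        by (rule bounded_sequence_weak_cluster_point[where x = x, OF M xM xbd]) (rule that)
      have lb: "l \<in> bounded_ops" by (rule von_neumann_algebra_bounded_ops[OF M l])
      obtain z where z: "(\<lambda>n. (?S ^^ n) (\<pi> a \<Omega>)) \<longlonglongrightarrow> z"
        using positive_contraction_powers_converge[OF adj Vn V'n] by blast
      \<comment> \<open>The multiplicative domain asks for equality at \<open>l\<close> and at its
        adjoint, so the orbit of the adjoint of \<open>a\<close> is followed as well.\<close>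
      obtain z' where z': "(\<lambda>n. (?S ^^ n) (\<pi> (cadjoint a) \<Omega>)) \<longlonglongrightarrow> z'"
        using positive_contraction_powers_converge[OF adj Vn V'n] by blast
      have "((\<lambda>n. \<pi> (x n) \<Omega>) \<longlongrightarrow> z) F"
        using tendsto_mono[OF F(2) z] gTn a(1) by (simp add: is_gns_contraction_def x_def)
      then have lz: "\<pi> l \<Omega> = z" by (rule gns_weak_limit[OF M st G xM l xbd lim F(1)])
      have "\<pi> (cadjoint (x n)) \<Omega> = (?S ^^ n) (\<pi> (cadjoint a) \<Omega>)" for n
      proof -
        have "cadjoint (x n) = (?T ^^ n) (cadjoint a)"
          unfolding x_def by (rule schwartz_map_cadjoint[OF M Tn a(1), symmetric])
        then show ?thesis using gTn[of n] cl a(1) by (simp add: is_gns_contraction_def)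
      qed
      then have zF': "((\<lambda>n. \<pi> (cadjoint (x n)) \<Omega>) \<longlongrightarrow> z') F"
        using tendsto_mono[OF F(2) z'] by simp
      \<comment> \<open>Taking adjoints only conjugates matrix coefficients, so the same filter
        \<open>F\<close> serves both orbits.\<close>
      have "((\<lambda>n. cinner u (cadjoint (x n) v)) \<longlongrightarrow> cinner u (cadjoint l v)) F" for u v
      proof -
        have "cinner u (cadjoint (x n) v) = cnj (cinner v (x n u))" for n
          by (metis cinner_cadjoint[OF xb] cinner_commute)
        moreover have "cinner u (cadjoint l v) = cnj (cinner v (l u))"
          by (metis cinner_cadjoint[OF lb] cinner_commute)
        ultimately show ?thesis using tendsto_cnj[OF lim[of v u]] by simp
      qed
      then have lz': "\<pi> (cadjoint l) \<Omega> = z'"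
        by (rule gns_weak_limit[OF M st G cl(7)[OF xM] cl(7)[OF l] norm_cadjoint_le[OF xb xbd] _ F(1) zF'])
      have "\<Phi> (cadjoint l \<circ> l) = \<Phi> (cadjoint l) \<circ> \<Phi> l"
        by (rule schwartz_equality_of_isometric[OF M st G S inv V l])
          (use fixed_limit[OF z] lz in simp_all)
      moreover have "\<Phi> (cadjoint (cadjoint l) \<circ> cadjoint l) = \<Phi> (cadjoint (cadjoint l)) \<circ> \<Phi> (cadjoint l)"
        by (rule schwartz_equality_of_isometric[OF M st G S inv V])
          (use fixed_limit[OF z'] lz' l cl in simp_all)
      ultimately have "l \<in> multiplicative_domain M \<Phi>"
        using l by (simp add: multiplicative_domain_def cadjoint_cadjoint[OF lb])
      moreover have "dist (\<pi> l \<Omega>) \<psi> \<le> dist (\<pi> a \<Omega>) \<psi>"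
      proof (rule LIMSEQ_le_const2)
        show "(\<lambda>n. dist ((?S ^^ n) (\<pi> a \<Omega>)) \<psi>) \<longlonglongrightarrow> dist (\<pi> l \<Omega>) \<psi>"
          unfolding lz by (intro tendsto_intros z)
        \<comment> \<open>The powers are contractions that fix \<psi>, so they bring no vector
          farther from it.\<close>
        have "dist ((?S ^^ n) (\<pi> a \<Omega>)) \<psi> \<le> dist (\<pi> a \<Omega>) \<psi>" for n
        proof -
          have Sb: "bounded_clinear (?S ^^ n)" "\<And>v. norm ((?S ^^ n) v) \<le> norm v"
            using gTn[of n] by (auto simp: is_gns_contraction_def)
          show ?thesis
            using Sb(2)[of "\<pi> a \<Omega> - \<psi>"] unfolding bounded_clinear_diff[OF Sb(1)] Sn\<psi> dist_norm .
        qed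
        then show "\<exists>N. \<forall>n\<ge>N. dist ((?S ^^ n) (\<pi> a \<Omega>)) \<psi> \<le> dist (\<pi> a \<Omega>) \<psi>" by blast
      qed
      ultimately show "\<exists>y\<in>?D. dist y \<psi> < e" using a(2) by (blast intro: le_less_trans)
    qed
  qed
qed

text \<open>Both sides are continuous in \<open>x\<close>, and at x = \<pi>(d)\<Omega> with
  \<open>d\<close> in the multiplicative domain they agree by
  \<open>schwartz_map_mult_right\<close>.\<close>

lemma gns_contraction_intertwines:
  assumes M: "von_neumann_algebra M" and G: "gns_representation M \<phi> \<pi> \<Omega>"
    and S: "unital_schwartz_map M \<Phi>" and V: "is_gns_contraction M \<Phi> \<pi> \<Omega> V" and a: "a \<in> M"
    and x: "x \<in> closure ((\<lambda>a. \<pi> a \<Omega>) ` multiplicative_domain M \<Phi>)"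
  shows "V (\<pi> a x) = \<pi> (\<Phi> a) (V x)"
proof -
  have Pa: "\<Phi> a \<in> M" by (rule schwartz_map_closed[OF S a])
  have bl: "bounded_linear V" "bounded_linear (\<pi> a)" "bounded_linear (\<pi> (\<Phi> a))"
    using V G a Pa by (auto simp: is_gns_contraction_def gns_representation_def bounded_ops_def
        bounded_clinear_bounded_linear)
  have "continuous_on T (\<lambda>x. V (\<pi> a x) - \<pi> (\<Phi> a) (V x))" for T
    by (intro linear_continuous_on bounded_linear_sub bounded_linear_compose[OF bl(1) bl(2)]
        bounded_linear_compose[OF bl(3) bl(1)])
  then have "V (\<pi> a x) - \<pi> (\<Phi> a) (V x) = 0"
  proof (rule continuous_constant_on_closure[OF _ _ x])
    fix y assume "y \<in> (\<lambda>a. \<pi> a \<Omega>) ` multiplicative_domain M \<Phi>"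
    then obtain d where d: "d \<in> M" "\<Phi> (cadjoint d \<circ> d) = \<Phi> (cadjoint d) \<circ> \<Phi> d" "y = \<pi> d \<Omega>"
      by (auto simp: multiplicative_domain_def)
    have mult: "\<pi> (b \<circ> c) \<Omega> = \<pi> b (\<pi> c \<Omega>)" if "b \<in> M" "c \<in> M" for b c
      using G that by (simp add: gns_representation_def)
    have VM: "V (\<pi> b \<Omega>) = \<pi> (\<Phi> b) \<Omega>" if "b \<in> M" for b
      using V that by (simp add: is_gns_contraction_def)
    have "V (\<pi> a y) = \<pi> (\<Phi> (a \<circ> d)) \<Omega>"
      using mult[OF a d(1)] VM[OF von_neumann_algebra_comp[OF M a d(1)]] d(3) by simp
    also have "\<dots> = \<pi> (\<Phi> a) (V y)"
      unfolding schwartz_map_mult_right[OF M S a d(1,2)]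
      using mult[OF Pa schwartz_map_closed[OF S d(1)]] VM[OF d(1)] d(3) by simp
    finally show "V (\<pi> a y) - \<pi> (\<Phi> a) (V y) = 0" by simp
  qed
  then show ?thesis by simp
qed

theorem proposition11:
  fixes M :: "('h::chilbert_space \<Rightarrow> 'h) set"
    and \<Phi> \<Phi>s :: "('h \<Rightarrow> 'h) \<Rightarrow> ('h \<Rightarrow> 'h)"
    and \<phi> :: "('h \<Rightarrow> 'h) \<Rightarrow> complex"
    and \<pi> :: "('h \<Rightarrow> 'h) \<Rightarrow> ('g::chilbert_space \<Rightarrow> 'g)"
    and \<Omega> :: 'g
    and U :: "'g \<Rightarrow> 'g"
  assumes "quantum_dynamical_system M \<Phi> \<phi>"
    and "is_state_adjoint M \<phi> \<Phi> \<Phi>s"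
    and "gns_representation M \<phi> \<pi> \<Omega>"
    and "is_gns_contraction M \<Phi> \<pi> \<Omega> U"
  shows "unitary_subspace U =
           (\<Inter>k::int. closure ((\<lambda>a. \<pi> a \<Omega>) ` multiplicative_domain M (int_iterate \<Phi> \<Phi>s k))) \<and>
         (\<forall>a\<in>M. \<forall>\<xi>\<^sub>0\<in>unitary_subspace U. \<forall>k::int.
            int_iterate U (cadjoint U) k (\<pi> a \<xi>\<^sub>0) =
            \<pi> (int_iterate \<Phi> \<Phi>s k a) (int_iterate U (cadjoint U) k \<xi>\<^sub>0))"
proof -
  have M: "von_neumann_algebra M" and S: "unital_schwartz_map M \<Phi>" and st: "normal_faithful_state M \<phi>"
    and inv: "\<And>a. a \<in> M \<Longrightarrow> \<phi> (\<Phi> a) = \<phi> a"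
    using assms(1) by (auto simp: quantum_dynamical_system_def)
  note G = assms(3) and U = assms(4)
  let ?U' = "cadjoint U"
  have Ss: "unital_schwartz_map M \<Phi>s" using assms(2) by (simp add: is_state_adjoint_def)
  \<comment> \<open>The adjoint relation at the identity, together with unitality of \<Phi>, gives
    invariance under \<open>\<Phi>s\<close>.\<close>
  have invs: "\<phi> (\<Phi>s b) = \<phi> b" if "b \<in> M" for b
    using assms(2) that von_neumann_algebra_id[OF M] schwartz_map_id[OF S]
    by (force simp: is_state_adjoint_def dest: bspec[where x = id])
  have U': "is_gns_contraction M \<Phi>s \<pi> \<Omega> ?U'"
    by (rule gns_contraction_cadjoint[OF M G assms(2) S U])
  have Ub: "U \<in> bounded_ops" using U by (simp add: is_gns_contraction_def bounded_ops_def)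
  have funpow_inv: "\<phi> ((\<Psi> ^^ n) a) = \<phi> a"
    if "unital_schwartz_map M \<Psi>" "\<And>a. a \<in> M \<Longrightarrow> \<phi> (\<Psi> a) = \<phi> a" "a \<in> M" for \<Psi> n a
    using that schwartz_map_closed[OF unital_schwartz_map_funpow[OF M that(1)]] by (induction n) auto
  note Sn = unital_schwartz_map_funpow[OF M S] unital_schwartz_map_funpow[OF M Ss]
  note gn = gns_contraction_funpow[OF U schwartz_map_closed[OF S]]
    gns_contraction_funpow[OF U' schwartz_map_closed[OF Ss]]
  have pos: "closure ((\<lambda>a. \<pi> a \<Omega>) ` multiplicative_domain M (\<Phi> ^^ n)) = {x. norm ((U ^^ n) x) = norm x}" for n
    by (rule isometric_vectors_eq_closure[OF M st G Sn(1) Sn(2) _ gn(1) gn(2)])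
      (simp_all add: funpow_inv[OF S inv] cinner_funpow_adjoint cadjoint_props(2)[OF Ub])
  have neg: "closure ((\<lambda>a. \<pi> a \<Omega>) ` multiplicative_domain M (\<Phi>s ^^ n)) = {x. norm ((?U' ^^ n) x) = norm x}" for n
    by (rule isometric_vectors_eq_closure[OF M st G Sn(2) Sn(1) _ gn(2) gn(1)])
      (simp_all add: funpow_inv[OF Ss invs] cinner_funpow_adjoint cinner_cadjoint'[OF Ub])
  have closure_eq: "closure ((\<lambda>a. \<pi> a \<Omega>) ` multiplicative_domain M (int_iterate \<Phi> \<Phi>s k))
      = {x. norm (int_iterate U ?U' k x) = norm x}" for k
    by (simp add: int_iterate_def pos neg)
  have subspace: "unitary_subspace U = (\<Inter>k. {x. norm (int_iterate U ?U' k x) = norm x})"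
  proof (rule set_eqI, rule iffI)
    fix x assume "x \<in> (\<Inter>k. {x. norm (int_iterate U ?U' k x) = norm x})"
    then have k: "norm (int_iterate U ?U' k x) = norm x" for k by blast
    have "norm ((U ^^ n) x) = norm x" for n using k[of "int n"] by (simp add: int_iterate_def)
    \<comment> \<open>Index 0 falls into the branch of \<open>U\<close> in
      \<open>int_iterate\<close>, so n = 0 is split off; there both powers are the identity.\<close>
    moreover have "norm ((?U' ^^ n) x) = norm x" for n
      using k[of "- int n"] by (cases n) (auto simp: int_iterate_def nat_add_distrib)
    ultimately show "x \<in> unitary_subspace U" by (simp add: unitary_subspace_def)
  qed (auto simp: unitary_subspace_def int_iterate_def)
  have intertwines: "int_iterate U ?U' k (\<pi> a x) = \<pi> (int_iterate \<Phi> \<Phi>s k a) (int_iterate U ?U' k x)"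
    if "a \<in> M" "x \<in> unitary_subspace U" for a x k
  proof (rule gns_contraction_intertwines[OF M G _ _ that(1)])
    show "unital_schwartz_map M (int_iterate \<Phi> \<Phi>s k)" by (simp add: int_iterate_def Sn)
    show "is_gns_contraction M (int_iterate \<Phi> \<Phi>s k) \<pi> \<Omega> (int_iterate U ?U' k)"
      by (simp add: int_iterate_def gn)
    show "x \<in> closure ((\<lambda>a. \<pi> a \<Omega>) ` multiplicative_domain M (int_iterate \<Phi> \<Phi>s k))"
      using that(2) unfolding subspace closure_eq by blast
  qed
  show ?thesis using subspace closure_eq intertwines by simp
qed

end
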